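(* Let $k$ be a positive integer and let $T\in\mathbb{M}_k$ be a $k\times k$ complex matrix. Then for every positive integer $n$, $$\begin{aligned}\omega(T)&=\frac{1}{n}\sup\{|\mathrm{Tr}\,X| \;:\; X\in W^n(T)\}\\&=\frac{1}{n}\sup\{\|X\|_1 \;:\; X\in W^n(T)\}\\&=\sup\{\omega(X) \;:\; X\in W^n(T)\}.\end{aligned}$$
   Context: $\mathbb{M}_n=\mathbb{M}_n(\mathbb{C})$ is the algebra of $n\times n$ complex matrices; it is identified with the bounded linear operators on $\mathbb{C}^n$ with its standard inner product. $\mathrm{Tr}$ denotes the canonical trace on $\mathbb{M}_n$, and $\|X\|_1=\mathrm{Tr}\,|X|$ with $|X|=(X^*X)^{1/2}$ is the trace norm. The numerical radius of a matrix $A$ is $\omega(A)=\sup\{|\langle Ax,x\rangle| : \|x\|=1\}$. $C^*(T)$ denotes the unital $C^*$-algebra generated by $T$ (and the identity operator). A linear map $\Phi:\mathscr{A}\to\mathscr{B}$ between unital $C^*$-algebras is completely positive if for every $m\in\mathbb{N}$ the map $[A_{ij}]\mapsto[\Phi(A_{ij})]$ from $\mathbb{M}_m(\mathscr{A})$ to $\mathbb{M}_m(\mathscr{B})$ sends positive elements to positive elements. $CP_n(T)$ is the set of all unital completely positive linear maps $\Phi:C^*(T)\to\mathbb{M}_n$, and the $n$'th matricial range of $T$ is $W^n(T)=\{\Phi(T) : \Phi\in CP_n(T)\}\subseteq\mathbb{M}_n$. *)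

theory Defs
  imports "Jordan_Normal_Form.Schur_Decomposition" "HOL-Library.Extended_Real"
begin

text \<open>
  The algebra of \<open>n \<times> n\<close> matrices is \<open>carrier_mat n n\<close>. The standard inner product of \<open>\<complex>\<^sup>n\<close>
  is \<open>v \<bullet>c w\<close>, linear in \<open>v\<close> and conjugate-linear in \<open>w\<close>.
\<close>

definition vec_nrm :: "complex vec \<Rightarrow> real" where
  "vec_nrm v = sqrt (Re (v \<bullet>c v))"

definition op_nrm :: "complex mat \<Rightarrow> real" where
  "op_nrm A = Sup {vec_nrm (A *\<^sub>v x) | x. x \<in> carrier_vec (dim_col A) \<and> vec_nrm x = 1}"

definition mat_trace :: "complex mat \<Rightarrow> complex" where
  "mat_trace A = (\<Sum>i<dim_row A. A $$ (i, i))"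

definition numerical_radius :: "complex mat \<Rightarrow> real" where
  "numerical_radius A =
     Sup {cmod ((A *\<^sub>v x) \<bullet>c x) | x. x \<in> carrier_vec (dim_col A) \<and> vec_nrm x = 1}"

text \<open>
  Positive operators on \<open>\<complex>\<^sup>n\<close>. In the order on \<^typ>\<open>complex\<close>, \<open>0 \<le> z\<close> means that \<open>z\<close> is real
  and nonnegative, so a positive matrix is self-adjoint.
\<close>
definition positive_mat :: "nat \<Rightarrow> complex mat \<Rightarrow> bool" where
  "positive_mat n A \<longleftrightarrow>
     A \<in> carrier_mat n n \<and> (\<forall>v \<in> carrier_vec n. 0 \<le> (A *\<^sub>v v) \<bullet>c v)"

text \<open>The unique positive square root; meaningful for positive \<open>A\<close>.\<close>
definition mat_sqrt :: "complex mat \<Rightarrow> complex mat" where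
  "mat_sqrt A = (THE B. positive_mat (dim_row A) B \<and> B * B = A)"

definition mat_abs :: "complex mat \<Rightarrow> complex mat" where
  "mat_abs X = mat_sqrt (mat_adjoint X * X)"

text \<open>The trace of \<open>mat_abs X\<close> is real; \<^const>\<open>Re\<close> only adjusts the type.\<close>
definition trace_norm :: "complex mat \<Rightarrow> real" where
  "trace_norm X = Re (mat_trace (mat_abs X))"

definition unital_cstar_subalgebra :: "nat \<Rightarrow> complex mat set \<Rightarrow> bool" where
  "unital_cstar_subalgebra k \<A> \<longleftrightarrow>
     \<A> \<subseteq> carrier_mat k k \<and>
     1\<^sub>m k \<in> \<A> \<and>
     (\<forall>A \<in> \<A>. \<forall>B \<in> \<A>. A + B \<in> \<A>) \<and>
     (\<forall>c. \<forall>A \<in> \<A>. c \<cdot>\<^sub>m A \<in> \<A>) \<and>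
     (\<forall>A \<in> \<A>. \<forall>B \<in> \<A>. A * B \<in> \<A>) \<and>
     (\<forall>A \<in> \<A>. mat_adjoint A \<in> \<A>) \<and>
     (\<forall>X L. (\<forall>i::nat. X i \<in> \<A>) \<and> L \<in> carrier_mat k k \<and>
        (\<lambda>i. op_nrm (X i - L)) \<longlonglongrightarrow> 0 \<longrightarrow> L \<in> \<A>)"

definition cstar_gen :: "complex mat \<Rightarrow> complex mat set" where
  "cstar_gen T = \<Inter> {\<A>. unital_cstar_subalgebra (dim_row T) \<A> \<and> T \<in> \<A>}"

text \<open>
  The \<open>m \<times> m\<close> array \<open>[F i j]\<close> of \<open>d \<times> d\<close> matrices as an operator on \<open>(\<complex>\<^sup>d)\<^sup>m = \<complex>\<^sup>m\<^sup>d\<close>: coordinate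
  \<open>i * d + a\<close> is the \<open>a\<close>-th coordinate in the \<open>i\<close>-th copy of \<open>\<complex>\<^sup>d\<close>.
\<close>
definition block_mat :: "nat \<Rightarrow> nat \<Rightarrow> (nat \<Rightarrow> nat \<Rightarrow> complex mat) \<Rightarrow> complex mat" where
  "block_mat d m F =
     mat (m * d) (m * d) (\<lambda>(p, q). F (p div d) (q div d) $$ (p mod d, q mod d))"

definition linear_mat_map :: "complex mat set \<Rightarrow> (complex mat \<Rightarrow> complex mat) \<Rightarrow> bool" where
  "linear_mat_map \<A> \<Phi> \<longleftrightarrow>
     (\<forall>A \<in> \<A>. \<forall>B \<in> \<A>. \<Phi> (A + B) = \<Phi> A + \<Phi> B) \<and>
     (\<forall>c. \<forall>A \<in> \<A>. \<Phi> (c \<cdot>\<^sub>m A) = c \<cdot>\<^sub>m \<Phi> A)"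

text \<open>
  Complete positivity for \<open>\<A> \<subseteq> carrier_mat k k\<close> and \<open>\<Phi>\<close> with values in \<open>carrier_mat n n\<close>.
  An element of \<open>M\<^sub>m(\<A>)\<close> is positive iff it is positive as an operator on \<open>(\<complex>\<^sup>k)\<^sup>m\<close>.
\<close>
definition completely_positive ::
    "nat \<Rightarrow> nat \<Rightarrow> complex mat set \<Rightarrow> (complex mat \<Rightarrow> complex mat) \<Rightarrow> bool" where
  "completely_positive k n \<A> \<Phi> \<longleftrightarrow>
     (\<forall>m F. (\<forall>i<m. \<forall>j<m. F i j \<in> \<A>) \<and> positive_mat (m * k) (block_mat k m F) \<longrightarrow>
        positive_mat (m * n) (block_mat n m (\<lambda>i j. \<Phi> (F i j))))"

text \<open>
  Maps on \<open>C\<^sup>*(T)\<close> are total functions of which only the values on \<open>cstar_gen T\<close> matter.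
\<close>
definition CP :: "nat \<Rightarrow> complex mat \<Rightarrow> (complex mat \<Rightarrow> complex mat) set" where
  "CP n T = {\<Phi>. (\<forall>A \<in> cstar_gen T. \<Phi> A \<in> carrier_mat n n) \<and>
     linear_mat_map (cstar_gen T) \<Phi> \<and>
     \<Phi> (1\<^sub>m (dim_row T)) = 1\<^sub>m n \<and>
     completely_positive (dim_row T) n (cstar_gen T) \<Phi>}"

definition matricial_range :: "nat \<Rightarrow> complex mat \<Rightarrow> complex mat set" where
  "matricial_range n T = (\<lambda>\<Phi>. \<Phi> T) ` CP n T"

end

theory Submission
  imports Defs "Jordan_Normal_Form.Spectral_Radius"
begin

text \<open>
  Every unitary is unitarily diagonalizable, so \<open>\<bar>Tr (X U)\<bar>\<close> is at most a sum of \<open>n\<close> values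
  \<open>\<bar>\<langle>X v, v\<rangle>\<bar>\<close> over an orthonormal basis; with the polar decomposition this gives
  \<open>\<bar>Tr X\<bar> \<le> n \<omega>(X)\<close> and \<open>\<parallel>X\<parallel>\<^sub>1 \<le> n \<omega>(X)\<close>. Unital positive maps do not increase the
  numerical radius, hence \<open>\<omega>(X) \<le> \<omega>(T)\<close> on \<open>W\<^sup>n(T)\<close>. Conversely each vector state
  \<open>A \<mapsto> \<langle>A x, x\<rangle> I\<close> puts the scalar matrix \<open>\<langle>T x, x\<rangle> I\<close> into \<open>W\<^sup>n(T)\<close>, and on
  scalar matrices all the bounds are attained.
\<close>

section \<open>Inner products and unitary matrices\<close>

text \<open>The detour through the operator norm would only bound the trace norm by 2 n \<omega>(X),
  since the operator norm can be twice \<omega>(X). Evaluating Tr (X U) in an eigenbasis of U avoids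
  this loss: only diagonal values of the form of X occur, with unimodular weights. For singular X
  the polar factor is a priori a partial isometry, but the trace bound asks for a unitary; hence
  orthogonal families are completed with zero vectors allowed among their members. The same
  completion drives the Schur triangularization behind the diagonalization. Since
  \<open>mat_sqrt\<close> is a definite description, existence and uniqueness of positive roots must
  both be settled before any trace norm can be evaluated.\<close>

lemma cinner_sum:
  assumes "x \<in> carrier_vec n" "y \<in> carrier_vec n"
  shows "x \<bullet>c y = (\<Sum>i<n. x $ i * cnj (y $ i))"
  using assms by (simp add: scalar_prod_def atLeast0LessThan)

lemma cinner_swap:
  assumes "x \<in> carrier_vec n" "y \<in> carrier_vec n"
  shows "y \<bullet>c x = cnj (x \<bullet>c y)"
  using assms by (simp add: cinner_sum[of _ n] mult.commute)

lemma cinner_smult_left: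
  fixes c :: complex
  assumes "x \<in> carrier_vec n" "y \<in> carrier_vec n"
  shows "(c \<cdot>\<^sub>v x) \<bullet>c y = c * (x \<bullet>c y)"
  using assms by (simp add: cinner_sum[of _ n] sum_distrib_left mult.assoc)

lemma cinner_smult_right:
  fixes c :: complex
  assumes "x \<in> carrier_vec n" "y \<in> carrier_vec n"
  shows "x \<bullet>c (c \<cdot>\<^sub>v y) = cnj c * (x \<bullet>c y)"
  using assms by (simp add: cinner_sum[of _ n] sum_distrib_left ac_simps)

lemma cinner_self:
  assumes "x \<in> carrier_vec n"
  shows "x \<bullet>c x = complex_of_real ((vec_nrm x)\<^sup>2)"
proof -
  have "0 \<le> x \<bullet>c x" by (rule conjugate_square_ge_0_vec)
  then show ?thesis
    by (simp add: vec_nrm_def less_eq_complex_def complex_eq_iff)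
qed

lemma vec_nrm_nonneg [simp]: "0 \<le> vec_nrm x"
proof -
  have "0 \<le> x \<bullet>c x" by (rule conjugate_square_ge_0_vec)
  then show ?thesis by (simp add: vec_nrm_def less_eq_complex_def)
qed

lemma vec_nrm_eq_0_iff:
  assumes "x \<in> carrier_vec n"
  shows "vec_nrm x = 0 \<longleftrightarrow> x = 0\<^sub>v n"
  using conjugate_square_eq_0_vec[OF assms] cinner_self[OF assms] by auto

lemma vec_nrm_smult:
  assumes "x \<in> carrier_vec n"
  shows "vec_nrm (c \<cdot>\<^sub>v x) = cmod c * vec_nrm x"
proof -
  have "(c \<cdot>\<^sub>v x) \<bullet>c (c \<cdot>\<^sub>v x) = (c * cnj c) * (x \<bullet>c x)"
    using assms by (simp add: cinner_smult_left[of _ n] cinner_smult_right[of _ n])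
  also have "\<dots> = complex_of_real ((cmod c * vec_nrm x)\<^sup>2)"
    by (simp add: cinner_self[OF assms] complex_norm_square[symmetric] power_mult_distrib)
  finally have "vec_nrm (c \<cdot>\<^sub>v x) = sqrt ((cmod c * vec_nrm x)\<^sup>2)"
    unfolding vec_nrm_def[of "c \<cdot>\<^sub>v x"] by simp
  then show ?thesis by (simp add: abs_mult)
qed

lemma vec_nrm_eq_1_iff:
  assumes "x \<in> carrier_vec n"
  shows "vec_nrm x = 1 \<longleftrightarrow> x \<bullet>c x = 1"
proof -
  have "x \<bullet>c x = 1 \<longleftrightarrow> (vec_nrm x)\<^sup>2 = 1"
    unfolding cinner_self[OF assms] of_real_eq_1_iff ..
  also have "\<dots> \<longleftrightarrow> vec_nrm x = 1"
    by (simp add: abs_square_eq_1)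
  finally show ?thesis by simp
qed

section \<open>Adjoints\<close>

lemma mat_adjoint_dim [simp]:
  "dim_row (mat_adjoint A) = dim_col A" "dim_col (mat_adjoint A) = dim_row A"
  by (auto simp: mat_adjoint_def mat_of_rows_def)

lemma mat_adjoint_index [simp]:
  fixes A :: "complex mat"
  assumes "i < dim_col A" "j < dim_row A"
  shows "mat_adjoint A $$ (i, j) = cnj (A $$ (j, i))"
  using assms by (simp add: mat_adjoint_def mat_of_rows_def)

lemma mat_adjoint_carrier [simp]:
  "A \<in> carrier_mat n m \<Longrightarrow> mat_adjoint A \<in> carrier_mat m n"
  by auto

lemma mat_adjoint_adjoint [simp]: "mat_adjoint (mat_adjoint A) = (A :: complex mat)"
  by (rule eq_matI) auto

lemma mat_adjoint_mult:
  fixes A B :: "complex mat"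
  assumes "A \<in> carrier_mat n m" "B \<in> carrier_mat m l"
  shows "mat_adjoint (A * B) = mat_adjoint B * mat_adjoint A"
  using assms by (intro eq_matI) (auto simp: scalar_prod_def intro!: sum.cong)

lemma mat_adjoint_mat_diag: "mat_adjoint (mat_diag n e) = mat_diag n (\<lambda>i. cnj (e i))"
  by (rule eq_matI) (auto simp: mat_diag_def)

lemma mat_adjoint_one [simp]: "mat_adjoint (1\<^sub>m n) = (1\<^sub>m n :: complex mat)"
  by (rule eq_matI) auto

lemma cinner_adjoint:
  fixes A :: "complex mat"
  assumes "A \<in> carrier_mat n m" "x \<in> carrier_vec m" "y \<in> carrier_vec n"
  shows "(A *\<^sub>v x) \<bullet>c y = x \<bullet>c (mat_adjoint A *\<^sub>v y)"
proof -
  have "(A *\<^sub>v x) \<bullet>c y = (\<Sum>i<n. \<Sum>j<m. A $$ (i, j) * x $ j * cnj (y $ i))"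
    using assms by (subst cinner_sum[of _ n])
      (auto simp: scalar_prod_def sum_distrib_right atLeast0LessThan intro!: sum.cong)
  also have "\<dots> = (\<Sum>j<m. \<Sum>i<n. A $$ (i, j) * x $ j * cnj (y $ i))"
    by (rule sum.swap)
  also have "\<dots> = x \<bullet>c (mat_adjoint A *\<^sub>v y)"
    using assms mult_mat_vec_carrier[OF mat_adjoint_carrier[OF assms(1)] assms(3)]
    by (subst cinner_sum[of _ m])
      (auto simp: scalar_prod_def sum_distrib_left atLeast0LessThan ac_simps intro!: sum.cong)
  finally show ?thesis .
qed

text \<open>A Gram matrix: this translates identities such as
  \<open>mat_adjoint U * U = 1\<^sub>m n\<close> into orthonormality of columns. The indices trade
  places because the inner product is conjugate-linear in its second argument.\<close>

lemma adjoint_mult_index: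
  fixes A B :: "complex mat"
  assumes "A \<in> carrier_mat n m" "B \<in> carrier_mat n l" "i < m" "j < l"
  shows "(mat_adjoint A * B) $$ (i, j) = col B j \<bullet>c col A i"
  using assms by (subst cinner_sum[of _ n])
    (auto simp: scalar_prod_def atLeast0LessThan ac_simps intro!: sum.cong)

text \<open>Equal \<open>U\<close> and \<open>W\<close> give the matrix of the operator in a new
  basis; the case of two different unitaries serves the singular value computation for the trace
  norm.\<close>

lemma adjoint_mult_mult_index:
  fixes A U W :: "complex mat"
  assumes "A \<in> carrier_mat n n" "U \<in> carrier_mat n n" "W \<in> carrier_mat n n" "i < n" "j < n"
  shows "(mat_adjoint W * A * U) $$ (i, j) = (A *\<^sub>v col U j) \<bullet>c col W i"
proof -
  have "mat_adjoint W * A * U = mat_adjoint W * (A * U)"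
    using assms by (intro assoc_mult_mat[of _ n n _ n _ n]) auto
  moreover have "col (A * U) j = A *\<^sub>v col U j"
    using assms by (intro col_mult2[of _ n n]) auto
  ultimately show ?thesis
    using assms adjoint_mult_index[of W n n "A * U" n i j] by simp
qed

section \<open>Unitary matrices\<close>

definition unitary_mat :: "nat \<Rightarrow> complex mat \<Rightarrow> bool" where
  "unitary_mat n U \<longleftrightarrow> U \<in> carrier_mat n n \<and> mat_adjoint U * U = 1\<^sub>m n"

lemma unitary_matD:
  assumes "unitary_mat n U"
  shows "U \<in> carrier_mat n n" "mat_adjoint U * U = 1\<^sub>m n" "U * mat_adjoint U = 1\<^sub>m n"
  using assms mat_mult_left_right_inverse[of "mat_adjoint U" n U]
  by (auto simp: unitary_mat_def)

lemma unitary_mat_one: "unitary_mat n (1\<^sub>m n)"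
  by (simp add: unitary_mat_def)

lemma unitary_mat_adjoint: "unitary_mat n U \<Longrightarrow> unitary_mat n (mat_adjoint U)"
  unfolding unitary_mat_def[of n "mat_adjoint U"] by (simp add: unitary_matD)

lemma unitary_mat_mult:
  assumes "unitary_mat n U" "unitary_mat n W"
  shows "unitary_mat n (U * W)"
proof -
  note U = unitary_matD[OF assms(1)] and W = unitary_matD[OF assms(2)]
  have "mat_adjoint (U * W) * (U * W) = mat_adjoint W * mat_adjoint U * (U * W)"
    using U W by (simp add: mat_adjoint_mult[of _ n n _ n])
  also have "\<dots> = mat_adjoint W * (mat_adjoint U * (U * W))"
    using U W by (intro assoc_mult_mat[of _ n n _ n _ n]) auto
  also have "mat_adjoint U * (U * W) = mat_adjoint U * U * W"
    using U W by (intro assoc_mult_mat[of _ n n _ n _ n, symmetric]) auto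
  finally show ?thesis using U W by (simp add: unitary_mat_def)
qed

lemma unitary_mat_col:
  assumes "unitary_mat n U" "i < n" "j < n"
  shows "col U j \<bullet>c col U i = (if i = j then 1 else 0)"
  using adjoint_mult_index[of U n n U n i j] unitary_matD[OF assms(1)] assms(2,3) by simp

lemma unitary_mat_col_nrm:
  assumes "unitary_mat n U" "i < n"
  shows "col U i \<in> carrier_vec n" "vec_nrm (col U i) = 1"
  using unitary_mat_col[of n U i i] unitary_matD(1)[OF assms(1)] assms
  by (auto simp: vec_nrm_eq_1_iff[of _ n])

section \<open>Completion of orthogonal families\<close>

text \<open>The conjugates of the \<open>f i\<close> are the rows of \<open>M\<close>. Row
  \<open>j\<close> is zero, so \<open>M\<close> is singular, and a kernel vector of \<open>M\<close>
  is orthogonal to every \<open>f i\<close>.\<close>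

lemma orthogonal_vec_exists:
  fixes f :: "nat \<Rightarrow> complex vec"
  assumes f: "\<And>i. i < n \<Longrightarrow> f i \<in> carrier_vec n" and j: "j < n" "f j = 0\<^sub>v n"
  shows "\<exists>v \<in> carrier_vec n. v \<noteq> 0\<^sub>v n \<and> (\<forall>i<n. v \<bullet>c f i = 0)"
proof -
  define M where "M = mat n n (\<lambda>(i, k). cnj (f i $ k))"
  have M: "M \<in> carrier_mat n n" by (simp add: M_def)
  have "transpose_mat M *\<^sub>v unit_vec n j = 0\<^sub>v n"
    using j M by (intro eq_vecI) (auto simp: M_def)
  moreover have "unit_vec n j \<noteq> (0\<^sub>v n :: complex vec)"
    using j(1) by (metis index_unit_vec(2) index_zero_vec(1) zero_neq_one)
  ultimately have "det (transpose_mat M) = 0"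
    using M j(1) by (subst det_0_iff_vec_prod_zero[of _ n]) (auto intro!: exI[of _ "unit_vec n j"])
  then have "det M = 0" using M by (simp add: det_transpose)
  then obtain v where v: "v \<in> carrier_vec n" "v \<noteq> 0\<^sub>v n" "M *\<^sub>v v = 0\<^sub>v n"
    using det_0_iff_vec_prod_zero[OF M] by auto
  have "v \<bullet>c f i = 0" if "i < n" for i
  proof -
    have "v \<bullet>c f i = (M *\<^sub>v v) $ i"
      using that v(1) f[OF that] M
      by (subst cinner_sum[of _ n]) (auto simp: M_def scalar_prod_def atLeast0LessThan intro!: sum.cong)
    then show ?thesis using v that by simp
  qed
  then show ?thesis using v by blast
qed

text \<open>Zero members act as empty slots. Each is replaced by a nonzero vector orthogonal to the
  whole family, so the induction runs over the number of zeros left.\<close>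

lemma orthogonal_completion:
  fixes f :: "nat \<Rightarrow> complex vec"
  assumes "\<And>i. i < n \<Longrightarrow> f i \<in> carrier_vec n"
    and "\<And>i j. i < n \<Longrightarrow> j < n \<Longrightarrow> i \<noteq> j \<Longrightarrow> f i \<bullet>c f j = 0"
  shows "\<exists>g. (\<forall>i<n. g i \<in> carrier_vec n \<and> g i \<noteq> 0\<^sub>v n \<and> (f i \<noteq> 0\<^sub>v n \<longrightarrow> g i = f i)) \<and>
    (\<forall>i<n. \<forall>j<n. i \<noteq> j \<longrightarrow> g i \<bullet>c g j = 0)"
  using assms
proof (induction "card {i. i < n \<and> f i = 0\<^sub>v n}" arbitrary: f)
  case 0
  then have "{i. i < n \<and> f i = 0\<^sub>v n} = {}" by simp
  then show ?case using 0 by (intro exI[of _ f]) auto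
next
  case (Suc m)
  then have "{i. i < n \<and> f i = 0\<^sub>v n} \<noteq> {}" by (metis card.empty nat.distinct(1))
  then obtain j where j: "j < n" "f j = 0\<^sub>v n" by auto
  obtain v where v: "v \<in> carrier_vec n" "v \<noteq> 0\<^sub>v n" "\<And>i. i < n \<Longrightarrow> v \<bullet>c f i = 0"
    using orthogonal_vec_exists[of n f j] Suc.prems j by blast
  have v': "f i \<bullet>c v = 0" if "i < n" for i
    using cinner_swap[OF v(1) Suc.prems(1)[OF that]] v(3)[OF that] by simp
  have "{i. i < n \<and> f i = 0\<^sub>v n} = insert j {i. i < n \<and> (f(j := v)) i = 0\<^sub>v n}"
    using j v by auto
  moreover have "j \<notin> {i. i < n \<and> (f(j := v)) i = 0\<^sub>v n}" using v by simp
  ultimately have "m = card {i. i < n \<and> (f(j := v)) i = 0\<^sub>v n}"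
    using Suc.hyps(2) by simp
  moreover have "(f(j := v)) i \<in> carrier_vec n" if "i < n" for i
    using that v Suc.prems(1) by simp
  moreover have "(f(j := v)) i \<bullet>c (f(j := v)) l = 0" if "i < n" "l < n" "i \<noteq> l" for i l
    using that v v' Suc.prems(2) by simp
  ultimately obtain g where
    g: "\<forall>i<n. g i \<in> carrier_vec n \<and> g i \<noteq> 0\<^sub>v n \<and> ((f(j := v)) i \<noteq> 0\<^sub>v n \<longrightarrow> g i = (f(j := v)) i)"
       "\<forall>i<n. \<forall>j<n. i \<noteq> j \<longrightarrow> g i \<bullet>c g j = 0"
    using Suc.hyps(1)[of "f(j := v)"] by blast
  have "\<forall>i<n. g i \<in> carrier_vec n \<and> g i \<noteq> 0\<^sub>v n \<and> (f i \<noteq> 0\<^sub>v n \<longrightarrow> g i = f i)"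
    using g(1) j by (metis fun_upd_other)
  with g(2) show ?case by blast
qed

text \<open>The equation with the factor \<open>vec_nrm (f i)\<close> treats all members alike: a
  nonzero \<open>f i\<close> is normalized to column \<open>i\<close>, and for a zero member the
  factor is 0 and the column is free.\<close>

lemma unitary_completion:
  fixes f :: "nat \<Rightarrow> complex vec"
  assumes f: "\<And>i. i < n \<Longrightarrow> f i \<in> carrier_vec n"
    and orth: "\<And>i j. i < n \<Longrightarrow> j < n \<Longrightarrow> i \<noteq> j \<Longrightarrow> f i \<bullet>c f j = 0"
  shows "\<exists>U. unitary_mat n U \<and> (\<forall>i<n. f i = complex_of_real (vec_nrm (f i)) \<cdot>\<^sub>v col U i)"
proof -
  obtain g where g: "\<And>i. i < n \<Longrightarrow> g i \<in> carrier_vec n" "\<And>i. i < n \<Longrightarrow> g i \<noteq> 0\<^sub>v n"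
      "\<And>i. i < n \<Longrightarrow> f i \<noteq> 0\<^sub>v n \<Longrightarrow> g i = f i"
      "\<And>i j. i < n \<Longrightarrow> j < n \<Longrightarrow> i \<noteq> j \<Longrightarrow> g i \<bullet>c g j = 0"
    using orthogonal_completion[of n f, OF f orth] by auto
  define U where "U = mat n n (\<lambda>(k, i). complex_of_real (1 / vec_nrm (g i)) * g i $ k)"
  have U: "U \<in> carrier_mat n n" by (simp add: U_def)
  have colU: "col U i = complex_of_real (1 / vec_nrm (g i)) \<cdot>\<^sub>v g i" if "i < n" for i
    using that g(1)[OF that] by (intro eq_vecI) (auto simp: U_def)
  have nz: "vec_nrm (g i) \<noteq> 0" if "i < n" for i
    using that g vec_nrm_eq_0_iff by blast
  have "col U j \<bullet>c col U i = (if i = j then 1 else 0)" if "i < n" "j < n" for i j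
  proof (cases "i = j")
    case True
    have "vec_nrm (col U i) = 1"
      using that nz[OF that(1)] by (simp add: colU vec_nrm_smult[OF g(1)] norm_divide)
    then show ?thesis using True U that by (simp add: vec_nrm_eq_1_iff[of _ n])
  next
    case False
    then show ?thesis using that g(4)[of j i] 
      by (simp add: colU cinner_smult_left[of _ n] cinner_smult_right[of _ n] g(1))
  qed
  then have "mat_adjoint U * U = 1\<^sub>m n"
    using U by (intro eq_matI) (auto simp: adjoint_mult_index[of U n n U n] simp del: index_mult_mat(1))
  moreover have "f i = complex_of_real (vec_nrm (f i)) \<cdot>\<^sub>v col U i" if i: "i < n" for i
  proof (cases "f i = 0\<^sub>v n")
    case True
    then have "vec_nrm (f i) = 0" using vec_nrm_eq_0_iff[OF f[OF i]] by simp
    then show ?thesis using True U by (intro eq_vecI) (use i in auto)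
  next
    case False
    then show ?thesis using i nz[OF i] g(3)[OF i] f[OF i]
      by (intro eq_vecI) (auto simp: colU)
  qed
  ultimately show ?thesis using U by (auto simp: unitary_mat_def)
qed

section \<open>Unitary diagonalization of normal matrices\<close>

lemma eigenvector_exists:
  fixes A :: "complex mat"
  assumes "A \<in> carrier_mat n n" "0 < n"
  shows "\<exists>v e. v \<in> carrier_vec n \<and> v \<noteq> 0\<^sub>v n \<and> A *\<^sub>v v = e \<cdot>\<^sub>v v"
proof -
  obtain e where "eigenvalue A e"
    using spectrum_non_empty[OF assms] by (auto simp: spectrum_def)
  then show ?thesis using assms unfolding eigenvalue_def eigenvector_def by auto
qed

text \<open>An eigenvector of the lower right block, padded with \<open>m\<close> zeros. The rows of
  \<open>B *\<^sub>v v\<close> above \<open>m\<close> are left uncontrolled; in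
  \<open>partial_schur\<close> they meet only columns that vanish there.\<close>

lemma lower_block_eigenvector:
  fixes B :: "complex mat"
  assumes B: "B \<in> carrier_mat n n" and m: "m < n"
  shows "\<exists>v e. v \<in> carrier_vec n \<and> v \<noteq> 0\<^sub>v n \<and> (\<forall>i<m. v $ i = 0) \<and>
    (\<forall>i. m \<le> i \<longrightarrow> i < n \<longrightarrow> (B *\<^sub>v v) $ i = e * v $ i)"
proof -
  define C where "C = mat (n - m) (n - m) (\<lambda>(i, j). B $$ (i + m, j + m))"
  obtain w e where w: "w \<in> carrier_vec (n - m)" "w \<noteq> 0\<^sub>v (n - m)" "C *\<^sub>v w = e \<cdot>\<^sub>v w"
    using eigenvector_exists[of C "n - m"] m by (auto simp: C_def)
  define v where "v = vec n (\<lambda>i. if i < m then 0 else w $ (i - m))"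
  have v: "v \<in> carrier_vec n" "\<forall>i<m. v $ i = 0" using m by (auto simp: v_def)
  obtain l where l: "l < n - m" "w $ l \<noteq> 0"
    using w(1,2) by (metis carrier_vecD eq_vecI index_zero_vec(1) index_zero_vec(2))
  then have "v $ (l + m) \<noteq> 0" "l + m < n" by (auto simp: v_def)
  then have "v \<noteq> 0\<^sub>v n" by auto
  moreover have "(B *\<^sub>v v) $ i = e * v $ i" if i: "m \<le> i" "i < n" for i
  proof -
    have "(B *\<^sub>v v) $ i = (\<Sum>j\<in>{0..<n}. B $$ (i, j) * v $ j)"
      using B v i by (simp add: scalar_prod_def)
    also have "\<dots> = (\<Sum>j\<in>{m..<n}. B $$ (i, j) * v $ j)"
      using v by (intro sum.mono_neutral_right) auto
    also have "\<dots> = (\<Sum>j\<in>{0..<n - m}. B $$ (i, j + m) * w $ j)"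
      using m sum.shift_bounds_nat_ivl[of "\<lambda>j. B $$ (i, j) * v $ j" 0 m "n - m"]
      by (simp add: v_def)
    also have "\<dots> = (C *\<^sub>v w) $ (i - m)"
      using w(1) i by (simp add: C_def scalar_prod_def)
    also have "\<dots> = e * v $ i" using w(1) i by (simp add: w(3) v_def del: index_mult_mat_vec)
    finally show ?thesis .
  qed
  ultimately show ?thesis using v by blast
qed

text \<open>With all dimensions fixed to \<open>n\<close>, the carrier premises of the rules can be
  discharged; products then associate to the right and adjoints move to the factors, so both sides
  of an identity meet.\<close>

lemmas square_mat_simps =
  mult_carrier_mat[of _ n n _ n] assoc_mult_mat[of _ n n _ n _ n]
  left_mult_one_mat[of _ n n] right_mult_one_mat[of _ n n]
  mat_adjoint_mult[of _ n n _ n] for n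

lemma unitary_conj_mult:
  fixes A :: "complex mat"
  assumes "A \<in> carrier_mat n n" "U \<in> carrier_mat n n" "W \<in> carrier_mat n n"
  shows "mat_adjoint (U * W) * A * (U * W) = mat_adjoint W * (mat_adjoint U * A * U) * W"
  using assms by (simp add: square_mat_simps[where n = n])

text \<open>Induction step: complete \<open>e\<^sub>0, \<dots>, e\<^sub>m\<^sub>-\<^sub>1, v\<close>, with \<open>v\<close> an eigenvector of the lower right
  block, to an orthonormal basis and conjugate by it.\<close>

lemma partial_schur:
  fixes A :: "complex mat"
  assumes A: "A \<in> carrier_mat n n"
  shows "m \<le> n \<Longrightarrow> \<exists>U. unitary_mat n U \<and>
    (\<forall>i j. j < m \<longrightarrow> j < i \<longrightarrow> i < n \<longrightarrow> (mat_adjoint U * A * U) $$ (i, j) = 0)"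
proof (induction m)
  case 0
  show ?case using unitary_mat_one by auto
next
  case (Suc m)
  then obtain U where U: "unitary_mat n U"
    and lower: "\<And>i j. j < m \<Longrightarrow> j < i \<Longrightarrow> i < n \<Longrightarrow> (mat_adjoint U * A * U) $$ (i, j) = 0"
    by auto
  define B where "B = mat_adjoint U * A * U"
  have B: "B \<in> carrier_mat n n"
    using A unitary_matD(1)[OF U] by (auto simp: B_def)
  have lowerB: "B $$ (i, j) = 0" if "j < m" "j < i" "i < n" for i j
    using lower that by (simp add: B_def)
  from Suc.prems have m: "m < n" by simp
  obtain v e where v: "v \<in> carrier_vec n" "v \<noteq> 0\<^sub>v n" "\<And>i. i < m \<Longrightarrow> v $ i = 0"
    and ev: "\<And>i. m \<le> i \<Longrightarrow> i < n \<Longrightarrow> (B *\<^sub>v v) $ i = e * v $ i"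
    using lower_block_eigenvector[OF B m] by blast
  \<comment> \<open>The zeros beyond position \<open>m\<close> are the slots that the completion
    fills.\<close>
  define f where "f j = (if j < m then unit_vec n j else if j = m then v else 0\<^sub>v n)" for j
  have f: "f j \<in> carrier_vec n" for j using v by (simp add: f_def)
  have fm: "f m = v" by (simp add: f_def)
  have fj: "f j = unit_vec n j" if "j < m" for j using that by (simp add: f_def)
  have "f i \<bullet>c f j = 0" if "i < n" "j < n" "i \<noteq> j" for i j
    unfolding cinner_sum[OF f f]
    using that v by (intro sum.neutral) (auto simp: f_def unit_vec_def)
  then obtain W where W: "unitary_mat n W"
    and fW: "\<And>j. j < n \<Longrightarrow> f j = complex_of_real (vec_nrm (f j)) \<cdot>\<^sub>v col W j"
    using unitary_completion[of n f] f by blast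
  have Wc: "W \<in> carrier_mat n n" using unitary_matD(1)[OF W] .
  have inner: "f j \<bullet>c col W i = 0" if "i < n" "j < n" "i \<noteq> j" for i j
  proof -
    have "f j \<bullet>c col W i = complex_of_real (vec_nrm (f j)) * (col W j \<bullet>c col W i)"
      using that unitary_mat_col_nrm(1)[OF W] by (subst fW) (auto simp: cinner_smult_left[of _ n])
    then show ?thesis using unitary_mat_col[OF W that(1,2)] that(3) by simp
  qed
  \<comment> \<open>Column \<open>i\<close> is orthogonal to the standard unit vector
    \<open>f l\<close>, so its \<open>l\<close>-th coordinate is 0.\<close>
  have Wl: "col W i $ l = 0" if "l < m" "i < n" "i \<noteq> l" for i l
  proof -
    have "f l \<bullet>c col W i = cnj (col W i $ l)"
      using that f unitary_mat_col_nrm(1)[OF W that(2)] m fj[OF that(1)]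
      by (subst cinner_sum[of _ n])
        (auto simp: unit_vec_def if_distrib[of "\<lambda>x. x * _"] cong: if_cong)
    then show ?thesis using inner[of i l] that m by simp
  qed
  \<comment> \<open>For \<open>j = m\<close>, \<open>B *\<^sub>v v\<close> agrees with
    \<open>e \<cdot>\<^sub>v v\<close> from row \<open>m\<close> on, and above that
    \<open>col W i\<close> vanishes. For \<open>j < m\<close>, triangularity confines
    \<open>B *\<^sub>v f j\<close> to rows up to \<open>j\<close>, where \<open>col W i\<close>
    vanishes as well.\<close>
  have fzero: "(B *\<^sub>v f j) \<bullet>c col W i = 0" if j: "j < Suc m" "j < i" "i < n" for i j
  proof -
    have ci: "col W i \<in> carrier_vec n" using unitary_mat_col_nrm(1)[OF W j(3)] .
    have Bf: "B *\<^sub>v f j \<in> carrier_vec n" using B f by simp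
    show ?thesis
    proof (cases "j = m")
      case True
      have "(B *\<^sub>v f j) \<bullet>c col W i = (\<Sum>l<n. (e \<cdot>\<^sub>v f j) $ l * cnj (col W i $ l))"
        unfolding cinner_sum[OF Bf ci]
      proof (rule sum.cong)
        fix l assume "l \<in> {..<n}"
        then show "(B *\<^sub>v f j) $ l * cnj (col W i $ l) = (e \<cdot>\<^sub>v f j) $ l * cnj (col W i $ l)"
          using Wl[of l i] ev[of l] v(1) True j
          by (cases "l < m") (simp_all add: fm del: index_mult_mat_vec)
      qed simp
      also have "\<dots> = e * (f j \<bullet>c col W i)"
        using f ci by (simp add: cinner_sum[of _ n, symmetric] cinner_smult_left[of _ n])
      finally show ?thesis using inner[of i j] j by simp
    next
      case False
      then have "j < m" using j by simp
      have "(B *\<^sub>v f j) $ l * cnj (col W i $ l) = 0" if "l < n" for l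
      proof (cases "l \<le> j")
        case True
        then show ?thesis using Wl[of l i] \<open>j < m\<close> j by simp
      next
        case False
        then have "(B *\<^sub>v f j) $ l = 0"
          using B that \<open>j < m\<close> m lowerB[of j l] by (simp add: fj)
        then show ?thesis by simp
      qed
      then show ?thesis unfolding cinner_sum[OF Bf ci] by (intro sum.neutral) auto
    qed
  qed
  have "(mat_adjoint W * B * W) $$ (i, j) = 0" if j: "j < Suc m" "j < i" "i < n" for i j
  proof -
    have jn: "j < n" using j by simp
    have "f j \<noteq> 0\<^sub>v n" using j(1) jn v fj[of j] by (cases "j = m") (auto simp: fm)
    then have nz: "vec_nrm (f j) \<noteq> 0" using vec_nrm_eq_0_iff[OF f] by blast
    have cj: "col W j \<in> carrier_vec n" using unitary_mat_col_nrm(1)[OF W jn] .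
    have ci: "col W i \<in> carrier_vec n" using unitary_mat_col_nrm(1)[OF W j(3)] .
    have "B *\<^sub>v f j = complex_of_real (vec_nrm (f j)) \<cdot>\<^sub>v (B *\<^sub>v col W j)"
      by (subst fW[OF jn]) (rule mult_mat_vec[OF B cj])
    then have "complex_of_real (vec_nrm (f j)) * ((B *\<^sub>v col W j) \<bullet>c col W i) = 0"
      using fzero[OF j] B cj ci by (simp add: cinner_smult_left[of _ n])
    then show ?thesis using nz adjoint_mult_mult_index[OF B Wc Wc j(3) jn] by simp
  qed
  then have "(mat_adjoint (U * W) * A * (U * W)) $$ (i, j) = 0" if "j < Suc m" "j < i" "i < n" for i j
    using that unitary_conj_mult[OF A unitary_matD(1)[OF U] Wc] by (simp add: B_def)
  then show ?case using unitary_mat_mult[OF U W] by blast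
qed

text \<open>Normality makes row \<open>i\<close> and column \<open>i\<close> equally long, by
  comparing the diagonal entries at \<open>(i, i)\<close>. Once the earlier rows are known to be
  diagonal, column \<open>i\<close> consists of its diagonal entry alone, which leaves no length for
  the rest of row \<open>i\<close>.\<close>

lemma normal_upper_triangular_diagonal:
  fixes B :: "complex mat"
  assumes B: "B \<in> carrier_mat n n"
    and ut: "\<And>i j. j < i \<Longrightarrow> i < n \<Longrightarrow> B $$ (i, j) = 0"
    and normal: "mat_adjoint B * B = B * mat_adjoint B"
  shows "i < n \<Longrightarrow> j < n \<Longrightarrow> i \<noteq> j \<Longrightarrow> B $$ (i, j) = 0"
proof (induction i arbitrary: j rule: less_induct)
  case (less i)
  show ?case
  proof (cases "j < i")
    case True
    then show ?thesis using ut less.prems by simp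
  next
    case False
    have "complex_of_real (\<Sum>k<n. (cmod (B $$ (k, i)))\<^sup>2) = (mat_adjoint B * B) $$ (i, i)"
      using B less.prems
      unfolding of_real_sum complex_norm_square
      by (simp add: scalar_prod_def atLeast0LessThan mult.commute del: complex_mult_cnj)
    also have "\<dots> = complex_of_real (\<Sum>k<n. (cmod (B $$ (i, k)))\<^sup>2)"
      unfolding normal of_real_sum complex_norm_square using B less.prems
      by (simp add: scalar_prod_def atLeast0LessThan)
    finally have eq: "(\<Sum>k<n. (cmod (B $$ (k, i)))\<^sup>2) = (\<Sum>k<n. (cmod (B $$ (i, k)))\<^sup>2)"
      by (simp only: of_real_eq_iff)
    \<comment> \<open>Above the diagonal this is the induction hypothesis for row \<open>k\<close>,
      below it triangularity.\<close>
    have "B $$ (k, i) = 0" if "k < n" "k \<noteq> i" for k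
      using that less.prems less.IH[of k i] ut[of i k] by (cases "k < i") auto
    then have "(\<Sum>k<n. (cmod (B $$ (k, i)))\<^sup>2) = (\<Sum>k<n. if k = i then (cmod (B $$ (i, i)))\<^sup>2 else 0)"
      by (intro sum.cong) auto
    also have "\<dots> = (cmod (B $$ (i, i)))\<^sup>2" using less.prems by simp
    finally have "(\<Sum>k\<in>{..<n} - {i}. (cmod (B $$ (i, k)))\<^sup>2) = 0"
      using eq less.prems by (simp add: sum.remove[of "{..<n}" i])
    then have "\<forall>k\<in>{..<n} - {i}. (cmod (B $$ (i, k)))\<^sup>2 = 0"
      by (subst (asm) sum_nonneg_eq_0_iff) auto
    then show ?thesis using less.prems by auto
  qed
qed

lemma unitary_conj_undo:
  assumes "unitary_mat n U" "A \<in> carrier_mat n n"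
  shows "U * (mat_adjoint U * A * U) * mat_adjoint U = A"
proof -
  note U = unitary_matD[OF assms(1)]
  note [simp] = assms(2) U(1)
  have "U * (mat_adjoint U * A * U) * mat_adjoint U = (U * mat_adjoint U) * A * (U * mat_adjoint U)"
    by (simp add: square_mat_simps[where n = n])
  then show ?thesis by (simp add: U(3) square_mat_simps[where n = n])
qed

text \<open>A Schur form inherits normality and is therefore diagonal. This is applied to unitary
  matrices, to positive ones and to differences of positive ones.\<close>

theorem normal_unitary_diagonalization:
  fixes A :: "complex mat"
  assumes A: "A \<in> carrier_mat n n" and normal: "mat_adjoint A * A = A * mat_adjoint A"
  shows "\<exists>U e. unitary_mat n U \<and> A = U * mat_diag n e * mat_adjoint U"
proof -
  obtain U where U: "unitary_mat n U"
    and ut: "\<And>i j. j < n \<Longrightarrow> j < i \<Longrightarrow> i < n \<Longrightarrow> (mat_adjoint U * A * U) $$ (i, j) = 0"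
    using partial_schur[OF A order_refl] by blast
  note Ud = unitary_matD[OF U]
  define B where "B = mat_adjoint U * A * U"
  note [simp] = A Ud(1) and sq = square_mat_simps[where n = n]
  have B: "B \<in> carrier_mat n n" by (simp add: B_def sq)
  have mid: "mat_adjoint U * X * U * (mat_adjoint U * Y * U) = mat_adjoint U * (X * Y) * U"
    if [simp]: "X \<in> carrier_mat n n" "Y \<in> carrier_mat n n" for X Y
  proof -
    have "mat_adjoint U * X * U * (mat_adjoint U * Y * U)
        = mat_adjoint U * X * (U * mat_adjoint U) * (Y * U)"
      by (simp add: sq)
    then show ?thesis by (simp add: Ud(3) sq)
  qed
  have adjB: "mat_adjoint B = mat_adjoint U * mat_adjoint A * U"
    by (simp add: B_def sq)
  have "mat_adjoint B * B = B * mat_adjoint B"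
    unfolding adjB unfolding B_def by (simp add: mid normal)
  then have diag: "B $$ (i, j) = 0" if "i < n" "j < n" "i \<noteq> j" for i j
    using normal_upper_triangular_diagonal[OF B _ _ that] ut by (auto simp: B_def)
  have "B = mat_diag n (\<lambda>i. B $$ (i, i))"
    using B diag by (intro eq_matI) (auto simp: mat_diag_def)
  then have "A = U * mat_diag n (\<lambda>i. B $$ (i, i)) * mat_adjoint U"
    using unitary_conj_undo[OF U A] by (metis B_def)
  then show ?thesis using U by blast
qed

section \<open>Positive square roots, trace norm and numerical radius\<close>

lemma mat_adjoint_minus:
  fixes A B :: "complex mat"
  assumes "A \<in> carrier_mat n m" "B \<in> carrier_mat n m"
  shows "mat_adjoint (A - B) = mat_adjoint A - mat_adjoint B"
  using assms by (intro eq_matI) auto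

lemma cinner_add_left:
  fixes x y z :: "complex vec"
  assumes "x \<in> carrier_vec n" "y \<in> carrier_vec n" "z \<in> carrier_vec n"
  shows "(x + y) \<bullet>c z = x \<bullet>c z + y \<bullet>c z"
  using assms by (simp add: cinner_sum[of _ n] sum.distrib algebra_simps)

lemma cinner_add_right:
  fixes x y z :: "complex vec"
  assumes "x \<in> carrier_vec n" "y \<in> carrier_vec n" "z \<in> carrier_vec n"
  shows "z \<bullet>c (x + y) = z \<bullet>c x + z \<bullet>c y"
  using assms by (simp add: cinner_sum[of _ n] sum.distrib algebra_simps)

lemma cinner_minus_left:
  fixes x y z :: "complex vec"
  assumes "x \<in> carrier_vec n" "y \<in> carrier_vec n" "z \<in> carrier_vec n"
  shows "(x - y) \<bullet>c z = x \<bullet>c z - y \<bullet>c z"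
  using assms by (simp add: cinner_sum[of _ n] sum_subtractf algebra_simps)

text \<open>Polarization: varying \<open>c\<close> isolates the mixed terms, which for unit vectors
  are matrix entries.\<close>

lemma quadratic_form_add:
  fixes A :: "complex mat"
  assumes A: "A \<in> carrier_mat n n" and x: "x \<in> carrier_vec n" and y: "y \<in> carrier_vec n"
  shows "(A *\<^sub>v (x + c \<cdot>\<^sub>v y)) \<bullet>c (x + c \<cdot>\<^sub>v y) =
    (A *\<^sub>v x) \<bullet>c x + c * ((A *\<^sub>v y) \<bullet>c x) + cnj c * ((A *\<^sub>v x) \<bullet>c y)
    + c * cnj c * ((A *\<^sub>v y) \<bullet>c y)"
proof -
  have "A *\<^sub>v (x + c \<cdot>\<^sub>v y) = A *\<^sub>v x + c \<cdot>\<^sub>v (A *\<^sub>v y)"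
    using A x y by (simp add: mult_add_distrib_mat_vec[of _ n n] mult_mat_vec[of _ n n])
  moreover have "A *\<^sub>v x \<in> carrier_vec n" "A *\<^sub>v y \<in> carrier_vec n" using A x y by auto
  ultimately show ?thesis using x y
    by (simp add: cinner_add_left[of _ n] cinner_add_right[of _ n] cinner_smult_left[of _ n]
      cinner_smult_right[of _ n] algebra_simps)
qed

lemma cinner_unit_vec:
  fixes A :: "complex mat"
  assumes "A \<in> carrier_mat n n" "i < n" "j < n"
  shows "(A *\<^sub>v unit_vec n j) \<bullet>c unit_vec n i = A $$ (i, j)"
  using assms
  by (subst cinner_sum[of _ n])
    (auto simp: unit_vec_def[of n i] if_distrib[of cnj] if_distrib[of "\<lambda>x. _ * x"] cong: if_cong)

lemma positive_matD:
  assumes "positive_mat n A"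
  shows "A \<in> carrier_mat n n" "\<And>v. v \<in> carrier_vec n \<Longrightarrow> 0 \<le> (A *\<^sub>v v) \<bullet>c v"
  using assms by (auto simp: positive_mat_def)

text \<open>A real-valued quadratic form forces self-adjointness over the complex field: at
  \<open>unit_vec n i + c \<cdot>\<^sub>v unit_vec n j\<close> the mixed terms must have imaginary
  part 0 for every \<open>c\<close>.\<close>

lemma positive_mat_adjoint:
  assumes "positive_mat n A"
  shows "mat_adjoint A = A"
proof (rule eq_matI)
  note A = positive_matD[OF assms]
  have real: "Im ((A *\<^sub>v v) \<bullet>c v) = 0" if "v \<in> carrier_vec n" for v
    using A(2)[OF that] by (simp add: less_eq_complex_def)
  fix i j assume "i < dim_row A" "j < dim_col A"
  then have ij: "i < n" "j < n" using A(1) by auto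
  have "Im (c * A $$ (i, j) + cnj c * A $$ (j, i)) = 0" for c
  proof -
    have "unit_vec n i + c \<cdot>\<^sub>v unit_vec n j \<in> carrier_vec n" by simp
    from real[OF this] real[of "unit_vec n i"] real[of "unit_vec n j"] show ?thesis
      unfolding quadratic_form_add[OF A(1) unit_vec_carrier unit_vec_carrier]
      using ij A(1) by (simp add: cinner_unit_vec)
  qed
  \<comment> \<open>\<open>c = 1\<close> makes the imaginary parts of the two entries opposite,
    \<open>c = \<i>\<close> makes their real parts equal.\<close>
  from this[of 1] this[of \<i>] show "mat_adjoint A $$ (i, j) = A $$ (i, j)"
    using ij A(1) by (simp add: complex_eq_iff)
qed (use positive_matD(1)[OF assms] in auto)

lemma unitary_conj_diag:
  assumes "unitary_mat n U" "A = U * mat_diag n e * mat_adjoint U"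
  shows "mat_adjoint U * A * U = mat_diag n e"
proof -
  note U = unitary_matD[OF assms(1)]
  note [simp] = U(1) and sq = square_mat_simps[where n = n]
  have "mat_adjoint U * A * U = mat_adjoint U * U * mat_diag n e * (mat_adjoint U * U)"
    unfolding assms(2) by (simp add: sq)
  then show ?thesis by (simp add: U(2) sq)
qed

lemma unitary_diag_cinner:
  assumes U: "unitary_mat n U" and A: "A = U * mat_diag n e * mat_adjoint U"
    and ij: "i < n" "j < n"
  shows "(A *\<^sub>v col U j) \<bullet>c col U i = (if i = j then e i else 0)"
proof -
  have "A \<in> carrier_mat n n"
    unfolding A using unitary_matD(1)[OF U] by (auto intro!: mult_carrier_mat[of _ n n])
  from adjoint_mult_mult_index[OF this unitary_matD(1)[OF U] unitary_matD(1)[OF U] ij]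
  show ?thesis
    unfolding unitary_conj_diag[OF U A] using ij by (cases "i = j") (simp_all add: mat_diag_def)
qed

lemma unitary_diag_mult_col:
  assumes U: "unitary_mat n U" and A: "A = U * mat_diag n e * mat_adjoint U" and j: "j < n"
  shows "A *\<^sub>v col U j = e j \<cdot>\<^sub>v col U j"
proof -
  note Ud = unitary_matD[OF U]
  note [simp] = Ud(1) and sq = square_mat_simps[where n = n]
  have "A * U = U * mat_diag n e * (mat_adjoint U * U)" unfolding A by (simp add: sq)
  then have AU: "A * U = U * mat_diag n e" by (simp add: Ud(2) sq)
  have "A \<in> carrier_mat n n" unfolding A by (simp add: sq)
  then have "A *\<^sub>v col U j = col (A * U) j"
    using j col_mult2[of A n n U n j] by simp
  also have "\<dots> = e j \<cdot>\<^sub>v col U j"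
    unfolding AU mat_diag_mult_right[OF Ud(1)]
    using j carrier_matD[OF Ud(1)] by (intro eq_vecI) (auto simp: mult.commute)
  finally show ?thesis .
qed

lemma unitary_diag_positive:
  assumes U: "unitary_mat n U" and A: "A = U * mat_diag n e * mat_adjoint U"
    and e: "\<And>i. i < n \<Longrightarrow> 0 \<le> e i"
  shows "positive_mat n A"
  unfolding positive_mat_def
proof (intro conjI ballI)
  note Ud = unitary_matD[OF U]
  have D: "mat_diag n e \<in> carrier_mat n n" by simp
  show "A \<in> carrier_mat n n"
    unfolding A using Ud(1) by (auto intro!: mult_carrier_mat[of _ n n])
  fix v :: "complex vec" assume v: "v \<in> carrier_vec n"
  \<comment> \<open>The coordinates of \<open>v\<close> in the eigenbasis, in which the form is the
    sum of the \<open>e i\<close> weighted by squared moduli.\<close>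
  define w where "w = mat_adjoint U *\<^sub>v v"
  have w: "w \<in> carrier_vec n" using Ud(1) v unfolding w_def by (auto intro!: mult_mat_vec_carrier)
  then have Dw: "mat_diag n e *\<^sub>v w \<in> carrier_vec n" by (auto intro!: mult_mat_vec_carrier)
  have "A *\<^sub>v v = U * mat_diag n e *\<^sub>v w"
    unfolding A w_def using Ud(1) v by (intro assoc_mult_mat_vec[of _ n n _ n]) auto
  also have "\<dots> = U *\<^sub>v (mat_diag n e *\<^sub>v w)"
    using Ud(1) w by (intro assoc_mult_mat_vec[of _ n n _ n]) auto
  finally have "(A *\<^sub>v v) \<bullet>c v = (mat_diag n e *\<^sub>v w) \<bullet>c w"
    using cinner_adjoint[OF Ud(1) Dw v] by (simp add: w_def)
  also have "\<dots> = (\<Sum>i<n. e i * (w $ i * cnj (w $ i)))"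
  proof -
    have "(mat_diag n e *\<^sub>v w) $ i = e i * w $ i" if "i < n" for i
      using that w by (simp add: mat_diag_def scalar_prod_def if_distrib[of "\<lambda>x. x * _"] cong: if_cong)
    then show ?thesis using w Dw by (simp add: cinner_sum[of _ n] mult.assoc del: index_mult_mat_vec)
  qed
  also have "0 \<le> \<dots>"
  proof (rule sum_nonneg)
    fix i assume "i \<in> {..<n}"
    then show "0 \<le> e i * (w $ i * cnj (w $ i))"
      using mult_nonneg_nonneg[OF e conjugate_square_positive[of "w $ i"]]
      by (simp del: complex_mult_cnj)
  qed
  finally show "0 \<le> (A *\<^sub>v v) \<bullet>c v" .
qed

lemma positive_mat_spectral:
  assumes "positive_mat n A"
  shows "\<exists>U s. unitary_mat n U \<and> (\<forall>i<n. 0 \<le> s i) \<and>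
    A = U * mat_diag n (\<lambda>i. complex_of_real (s i)) * mat_adjoint U"
proof -
  obtain U e where U: "unitary_mat n U" and A: "A = U * mat_diag n e * mat_adjoint U"
    using normal_unitary_diagonalization[OF positive_matD(1)[OF assms]]
      positive_mat_adjoint[OF assms] by auto
  have e: "0 \<le> e i" if "i < n" for i
    using positive_matD(2)[OF assms unitary_mat_col_nrm(1)[OF U that]]
      unitary_diag_cinner[OF U A that that] by simp
  then have "mat_diag n e = mat_diag n (\<lambda>i. complex_of_real (Re (e i)))"
    by (intro eq_matI) (auto simp: mat_diag_def less_eq_complex_def complex_eq_iff)
  then show ?thesis using U A e
    by (intro exI[of _ U] exI[of _ "\<lambda>i. Re (e i)"]) (auto simp: less_eq_complex_def)
qed

lemma positive_sqrt_exists: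
  assumes "positive_mat n A"
  shows "\<exists>B. positive_mat n B \<and> B * B = A"
proof -
  obtain U s where U: "unitary_mat n U" and s: "\<forall>i<n. 0 \<le> s i"
    and A: "A = U * mat_diag n (\<lambda>i. complex_of_real (s i)) * mat_adjoint U"
    using positive_mat_spectral[OF assms] by blast
  note Ud = unitary_matD[OF U]
  note [simp] = Ud(1) and sq = square_mat_simps[where n = n]
  define D where "D = mat_diag n (\<lambda>i. complex_of_real (sqrt (s i)))"
  have [simp]: "D \<in> carrier_mat n n" by (simp add: D_def)
  define B where "B = U * D * mat_adjoint U"
  have "D * D = mat_diag n (\<lambda>i. complex_of_real (s i))"
    using s unfolding D_def mat_diag_diag
    by (intro eq_matI) (auto simp: mat_diag_def simp flip: of_real_mult)
  moreover have "B * B = U * D * (mat_adjoint U * U) * D * mat_adjoint U"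
    unfolding B_def by (simp add: sq)
  moreover have "\<dots> = U * (D * D) * mat_adjoint U" by (simp add: Ud(2) sq)
  ultimately have "B * B = A" by (simp add: A)
  moreover have "positive_mat n B"
    using s by (intro unitary_diag_positive[OF U B_def[unfolded D_def]]) (auto simp: less_eq_complex_def)
  ultimately show ?thesis by blast
qed

text \<open>For \<open>D = B - C\<close> one has \<open>B D + D C = 0\<close>; testing this on an eigenvector of \<open>D\<close> shows
  that every eigenvalue of \<open>D\<close> vanishes.\<close>

lemma positive_sqrt_unique:
  assumes B: "positive_mat n B" and C: "positive_mat n C" and eq: "B * B = C * C"
  shows "B = C"
proof -
  note Bc = positive_matD[OF B] and Cc = positive_matD[OF C]
  define D where "D = B - C"
  have D: "D \<in> carrier_mat n n" unfolding D_def using Cc(1) by (rule minus_carrier_mat)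
  have adj: "mat_adjoint D = D"
    unfolding D_def mat_adjoint_minus[OF Bc(1) Cc(1)]
    by (simp add: positive_mat_adjoint[OF B] positive_mat_adjoint[OF C])
  obtain U e where U: "unitary_mat n U" and DU: "D = U * mat_diag n e * mat_adjoint U"
    using normal_unitary_diagonalization[OF D] adj by auto
  have "e i = 0" if i: "i < n" for i
  proof -
    define u where "u = col U i"
    have u: "u \<in> carrier_vec n" and uu: "u \<bullet>c u = 1"
      using unitary_mat_col_nrm(1)[OF U i] unitary_mat_col[OF U i i] by (auto simp: u_def)
    have Du: "D *\<^sub>v u = e i \<cdot>\<^sub>v u"
      using unitary_diag_mult_col[OF U DU i] by (simp add: u_def)
    define b c where "b = (B *\<^sub>v u) \<bullet>c u" and "c = (C *\<^sub>v u) \<bullet>c u"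
    have bc: "0 \<le> b" "0 \<le> c" using Bc(2)[OF u] Cc(2)[OF u] by (auto simp: b_def c_def)
    have Bu: "B *\<^sub>v u \<in> carrier_vec n" and Cu: "C *\<^sub>v u \<in> carrier_vec n"
      using Bc(1) Cc(1) u by (auto intro: mult_mat_vec_carrier)
    have Du': "D *\<^sub>v u = B *\<^sub>v u - C *\<^sub>v u"
      using Bc(1) Cc(1) u by (simp add: D_def minus_mult_distrib_mat_vec[of _ n n])
    have ei: "e i = b - c"
      using Du' Du uu u Bu Cu
      by (metis b_def c_def cinner_minus_left cinner_smult_left mult.right_neutral)
    have "(B *\<^sub>v (D *\<^sub>v u)) \<bullet>c u = e i * b"
      unfolding Du b_def using Bc(1) u Bu
      by (simp add: mult_mat_vec[of _ n n] cinner_smult_left[of _ n])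
    moreover have "(D *\<^sub>v (C *\<^sub>v u)) \<bullet>c u = cnj (e i) * c"
      unfolding cinner_adjoint[OF D Cu u] adj Du c_def using u Cu
      by (simp add: cinner_smult_right[of _ n])
    moreover have "B *\<^sub>v (D *\<^sub>v u) + D *\<^sub>v (C *\<^sub>v u) = 0\<^sub>v n"
    proof -
      have "B *\<^sub>v (D *\<^sub>v u) = (B * B) *\<^sub>v u - B *\<^sub>v (C *\<^sub>v u)"
        unfolding Du' using Bc(1) u Bu Cu
        by (simp add: mult_minus_distrib_mat_vec[of _ n n] assoc_mult_mat_vec[of _ n n _ n])
      moreover have "D *\<^sub>v (C *\<^sub>v u) = B *\<^sub>v (C *\<^sub>v u) - (C * C) *\<^sub>v u"
        unfolding D_def using Bc(1) Cc(1) u Bu Cu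
        by (simp add: minus_mult_distrib_mat_vec[of _ n n] assoc_mult_mat_vec[of _ n n _ n])
      ultimately show ?thesis using eq Bc(1) Cc(1) by (intro eq_vecI) auto
    qed
    ultimately have "e i * b + cnj (e i) * c = 0"
      using cinner_add_left[of "B *\<^sub>v (D *\<^sub>v u)" n "D *\<^sub>v (C *\<^sub>v u)" u] Bc(1) D u Bu Cu
      by (metis mult_mat_vec_carrier carrier_vec_conjugate scalar_prod_left_zero)
    \<comment> \<open>Since \<open>e i = b - c\<close> is real, the equation reads (b - c) (b + c) =
      0, and nonnegativity turns equal squares into equal numbers.\<close>
    then have "Re b * Re b = Re c * Re c"
      using bc by (simp add: ei less_eq_complex_def complex_eq_iff algebra_simps)
    then have "Re b = Re c" using bc by (auto simp: less_eq_complex_def square_eq_iff)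
    then show "e i = 0" using bc by (simp add: ei less_eq_complex_def complex_eq_iff)
  qed
  then have "mat_diag n e = 0\<^sub>m n n" by (intro eq_matI) (auto simp: mat_diag_def)
  then have "D = 0\<^sub>m n n"
    unfolding DU using unitary_matD(1)[OF U] by (simp add: right_mult_zero_mat[of _ n n] left_mult_zero_mat[of _ n n])
  then have "(B - C) $$ (i, j) = 0" if "i < n" "j < n" for i j
    using that by (simp add: D_def)
  then show "B = C" using Bc(1) Cc(1) by (intro eq_matI) auto
qed

text \<open>By uniqueness, exhibiting one positive root evaluates the definite description.\<close>

lemma mat_sqrt_eqI:
  assumes "positive_mat n B" "B * B = A"
  shows "mat_sqrt A = B"
proof -
  have "dim_row A = n" using assms(2) positive_matD(1)[OF assms(1)] by auto
  then show ?thesis unfolding mat_sqrt_def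
    using assms positive_sqrt_unique by (intro the_equality) auto
qed

lemma positive_adjoint_mult:
  assumes "X \<in> carrier_mat m n"
  shows "positive_mat n (mat_adjoint X * X)"
  unfolding positive_mat_def
proof (intro conjI ballI)
  show "mat_adjoint X * X \<in> carrier_mat n n" using assms by auto
  fix v :: "complex vec" assume v: "v \<in> carrier_vec n"
  have Xv: "X *\<^sub>v v \<in> carrier_vec m" using assms v by auto
  have "(mat_adjoint X * X *\<^sub>v v) \<bullet>c v = (X *\<^sub>v v) \<bullet>c (X *\<^sub>v v)"
    using cinner_adjoint[of "mat_adjoint X" n m "X *\<^sub>v v" v] assms v Xv
    by (simp add: assoc_mult_mat_vec[of _ n m _ n])
  then show "0 \<le> (mat_adjoint X * X *\<^sub>v v) \<bullet>c v"
    by (simp only: conjugate_square_ge_0_vec)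
qed

lemma mat_abs:
  assumes "X \<in> carrier_mat n n"
  shows "positive_mat n (mat_abs X)" "mat_abs X * mat_abs X = mat_adjoint X * X"
proof -
  obtain B where "positive_mat n B" "B * B = mat_adjoint X * X"
    using positive_sqrt_exists[OF positive_adjoint_mult[OF assms]] by blast
  then show "positive_mat n (mat_abs X)" "mat_abs X * mat_abs X = mat_adjoint X * X"
    using mat_sqrt_eqI[of n B] by (simp_all add: mat_abs_def)
qed

section \<open>Trace\<close>

lemma mat_trace_comm:
  assumes "A \<in> carrier_mat n m" "B \<in> carrier_mat m n"
  shows "mat_trace (A * B) = mat_trace (B * A)"
proof -
  have "mat_trace (A * B) = (\<Sum>i<n. \<Sum>j<m. A $$ (i, j) * B $$ (j, i))"
    using assms by (simp add: mat_trace_def scalar_prod_def atLeast0LessThan)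
  also have "\<dots> = (\<Sum>j<m. \<Sum>i<n. A $$ (i, j) * B $$ (j, i))" by (rule sum.swap)
  also have "\<dots> = mat_trace (B * A)"
    using assms by (simp add: mat_trace_def scalar_prod_def atLeast0LessThan mult.commute)
  finally show ?thesis .
qed

lemma mat_trace_unitary_conj:
  assumes "unitary_mat n U" "A \<in> carrier_mat n n"
  shows "mat_trace (U * A * mat_adjoint U) = mat_trace A"
proof -
  note U = unitary_matD[OF assms(1)]
  note [simp] = U(1) assms(2) and sq = square_mat_simps[where n = n]
  have "mat_trace (U * (A * mat_adjoint U)) = mat_trace (A * mat_adjoint U * U)"
    by (rule mat_trace_comm[of _ n n]) (simp_all add: sq)
  then show ?thesis by (simp add: sq U(2))
qed

lemma mat_trace_mat_diag: "mat_trace (mat_diag n e) = (\<Sum>i<n. e i)"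
  by (simp add: mat_trace_def mat_diag_def)

section \<open>Numerical radius and its bounds on traces\<close>

lemma unit_vec_component_le:
  assumes "x \<in> carrier_vec n" "vec_nrm x = 1" "i < n"
  shows "cmod (x $ i) \<le> 1"
proof -
  have "complex_of_real (\<Sum>i<n. (cmod (x $ i))\<^sup>2) = x \<bullet>c x"
    unfolding of_real_sum complex_norm_square using assms by (simp add: cinner_sum[of _ n])
  then have "(\<Sum>i<n. (cmod (x $ i))\<^sup>2) = 1"
    using assms vec_nrm_eq_1_iff[of x n] by (metis of_real_eq_1_iff)
  moreover have "(cmod (x $ i))\<^sup>2 \<le> (\<Sum>i<n. (cmod (x $ i))\<^sup>2)"
    using assms(3) by (intro member_le_sum) auto
  ultimately show ?thesis by (simp add: abs_square_le_1)
qed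

text \<open>A real \<open>Sup\<close> dominates its set only if the set is bounded; the crude sum of
  the moduli of all entries is enough for that.\<close>

lemma bdd_above_numerical_values:
  assumes A: "A \<in> carrier_mat n n"
  shows "bdd_above {cmod ((A *\<^sub>v x) \<bullet>c x) | x. x \<in> carrier_vec (dim_col A) \<and> vec_nrm x = 1}"
proof (rule bdd_aboveI)
  fix r assume "r \<in> {cmod ((A *\<^sub>v x) \<bullet>c x) | x. x \<in> carrier_vec (dim_col A) \<and> vec_nrm x = 1}"
  then obtain x where x: "x \<in> carrier_vec n" "vec_nrm x = 1" and r: "r = cmod ((A *\<^sub>v x) \<bullet>c x)"
    using A by auto
  have "(A *\<^sub>v x) \<bullet>c x = (\<Sum>i<n. \<Sum>j<n. A $$ (i, j) * x $ j * cnj (x $ i))"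
    using A x(1) by (subst cinner_sum[of _ n])
      (auto simp: scalar_prod_def sum_distrib_right atLeast0LessThan intro!: sum.cong)
  also have "cmod \<dots> \<le> (\<Sum>i<n. \<Sum>j<n. cmod (A $$ (i, j)))"
  proof (intro sum_norm_le)
    fix i j assume "i \<in> {..<n}" "j \<in> {..<n}"
    then have "cmod (x $ i) \<le> 1" "cmod (x $ j) \<le> 1" using unit_vec_component_le x by auto
    then have "cmod (x $ j) * cmod (x $ i) \<le> 1" by (simp add: mult_le_one)
    then show "cmod (A $$ (i, j) * x $ j * cnj (x $ i)) \<le> cmod (A $$ (i, j))"
      by (simp add: norm_mult mult.assoc mult_left_le)
  qed
  finally show "r \<le> (\<Sum>i<n. \<Sum>j<n. cmod (A $$ (i, j)))" by (simp add: r)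
qed

lemma numerical_radius_ge:
  assumes "A \<in> carrier_mat n n" "x \<in> carrier_vec n" "vec_nrm x = 1"
  shows "cmod ((A *\<^sub>v x) \<bullet>c x) \<le> numerical_radius A"
  unfolding numerical_radius_def
  using assms by (intro cSup_upper[OF _ bdd_above_numerical_values]) auto

lemma unit_vec_nrm:
  assumes "i < n"
  shows "vec_nrm (unit_vec n i) = 1"
  using assms by (simp add: vec_nrm_eq_1_iff[of _ n] conjugate_vec_def unit_vec_def scalar_prod_def 
    if_distrib[of cnj] if_distrib[of "\<lambda>x. _ * x"] cong: if_cong)

lemma numerical_radius_le:
  assumes "A \<in> carrier_mat n n" "0 < n"
    and "\<And>x. x \<in> carrier_vec n \<Longrightarrow> vec_nrm x = 1 \<Longrightarrow> cmod ((A *\<^sub>v x) \<bullet>c x) \<le> w"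
  shows "numerical_radius A \<le> w"
  unfolding numerical_radius_def
proof (rule cSup_least)
  show "{cmod ((A *\<^sub>v x) \<bullet>c x) | x. x \<in> carrier_vec (dim_col A) \<and> vec_nrm x = 1} \<noteq> {}"
    using unit_vec_nrm[OF assms(2)] assms(1) by (auto intro!: exI[of _ "unit_vec n 0"])
qed (use assms in auto)

lemma mat_trace_unitary_mult_le:
  assumes X: "X \<in> carrier_mat n n" and U: "unitary_mat n U"
  shows "cmod (mat_trace (X * U)) \<le> real n * numerical_radius X"
proof -
  note Ud = unitary_matD[OF U]
  obtain V e where V: "unitary_mat n V" and UV: "U = V * mat_diag n e * mat_adjoint V"
    using normal_unitary_diagonalization[OF Ud(1)] Ud by auto
  note Vd = unitary_matD[OF V]
  note [simp] = X Vd(1) and sq = square_mat_simps[where n = n]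
  \<comment> \<open>The conjugate of \<open>U\<close> by \<open>V\<close> is both unitary and
    diagonal.\<close>
  have e: "cmod (e i) = 1" if i: "i < n" for i
  proof -
    have "unitary_mat n (mat_adjoint V * U * V)"
      using U V by (intro unitary_mat_mult unitary_mat_adjoint)
    then have "mat_adjoint (mat_diag n e) * mat_diag n e = 1\<^sub>m n"
      unfolding unitary_conj_diag[OF V UV] by (simp add: unitary_mat_def)
    then have "mat_diag n (\<lambda>i. cnj (e i) * e i) $$ (i, i) = 1\<^sub>m n $$ (i, i)"
      by (simp add: mat_adjoint_mat_diag)
    then have "complex_of_real ((cmod (e i))\<^sup>2) = 1"
      unfolding complex_norm_square using i by (simp add: mat_diag_def mult.commute)
    then have "(cmod (e i))\<^sup>2 = 1" unfolding of_real_eq_1_iff .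
    then show ?thesis by (simp add: abs_square_eq_1)
  qed
  have "mat_trace (X * U) = mat_trace (X * V * mat_diag n e * mat_adjoint V)"
    unfolding UV by (simp add: sq)
  also have "\<dots> = mat_trace (mat_adjoint V * (X * V * mat_diag n e))"
    by (rule mat_trace_comm[of _ n n]) (simp_all add: sq)
  also have "mat_adjoint V * (X * V * mat_diag n e) = mat_adjoint V * X * V * mat_diag n e"
    by (simp add: sq)
  also have "mat_trace \<dots> = (\<Sum>i<n. (X *\<^sub>v col V i) \<bullet>c col V i * e i)"
  proof -
    have car: "mat_adjoint V * X * V \<in> carrier_mat n n" by (simp add: sq)
    show ?thesis
      unfolding mat_diag_mult_right[OF car]
      by (simp add: mat_trace_def adjoint_mult_mult_index[of _ n] del: index_mult_mat(1))
  qed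
  also have "cmod \<dots> \<le> (\<Sum>i<n. numerical_radius X)"
    using e numerical_radius_ge[OF X] unitary_mat_col_nrm[OF V]
    by (intro sum_norm_le) (simp add: norm_mult)
  finally show ?thesis by simp
qed

lemma mat_trace_le_numerical_radius:
  assumes "X \<in> carrier_mat n n"
  shows "cmod (mat_trace X) \<le> real n * numerical_radius X"
  using mat_trace_unitary_mult_le[OF assms unitary_mat_one] assms by simp

theorem trace_norm_le_numerical_radius:
  assumes X: "X \<in> carrier_mat n n"
  shows "trace_norm X \<le> real n * numerical_radius X"
proof -
  note P = mat_abs[OF X]
  obtain V s where V: "unitary_mat n V" and s: "\<forall>i<n. 0 \<le> s i"
    and PV: "mat_abs X = V * mat_diag n (\<lambda>i. complex_of_real (s i)) * mat_adjoint V"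
    using positive_mat_spectral[OF P(1)] by blast
  note Vd = unitary_matD[OF V]
  define f where "f i = X *\<^sub>v col V i" for i
  have f: "f i \<in> carrier_vec n" if "i < n" for i
    using X unitary_mat_col_nrm(1)[OF V that] by (auto simp: f_def)
  \<comment> \<open>The inner products of the \<open>f i\<close> are those of the eigenvectors
    against \<open>mat_adjoint X * X\<close>, the square of \<open>mat_abs X\<close>; so the images
    of the eigenbasis are orthogonal with the singular values as lengths.\<close>
  have ff: "f j \<bullet>c f i = (if i = j then complex_of_real ((s i)\<^sup>2) else 0)"
    if ij: "i < n" "j < n" for i j
  proof -
    note ci = unitary_mat_col_nrm(1)[OF V ij(1)] and cj = unitary_mat_col_nrm(1)[OF V ij(2)]
    have Pc: "mat_abs X \<in> carrier_mat n n" using positive_matD(1)[OF P(1)] .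
    have "f j \<bullet>c f i = cnj (f i \<bullet>c f j)" using f ij by (intro cinner_swap) auto
    also have "f i \<bullet>c f j = col V i \<bullet>c (mat_adjoint X *\<^sub>v f j)"
      unfolding f_def[of i] by (rule cinner_adjoint[OF X ci f[OF ij(2)]])
    also have "mat_adjoint X *\<^sub>v f j = mat_abs X * mat_abs X *\<^sub>v col V j"
      unfolding P(2) f_def using X cj by (intro assoc_mult_mat_vec[of _ n n _ n, symmetric]) auto
    also have "\<dots> = complex_of_real (s j) \<cdot>\<^sub>v (complex_of_real (s j) \<cdot>\<^sub>v col V j)"
      using Pc cj unitary_diag_mult_col[OF V PV ij(2)]
      by (simp add: assoc_mult_mat_vec[of _ n n _ n] mult_mat_vec[of _ n n])
    finally show ?thesis
      using ci cj unitary_mat_col[OF V ij(2,1)]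
      by (auto simp: cinner_smult_right[of _ n] power2_eq_square)
  qed
  \<comment> \<open>This gives X V = W diag(s), a singular value decomposition, also when some
    \<open>s i\<close> vanish.\<close>
  obtain W where W: "unitary_mat n W"
    and fW: "\<And>i. i < n \<Longrightarrow> f i = complex_of_real (vec_nrm (f i)) \<cdot>\<^sub>v col W i"
    using unitary_completion[of n f] f ff by auto
  note Wd = unitary_matD[OF W]
  have nf: "vec_nrm (f i) = s i" if "i < n" for i
    using ff[OF that that] s that by (simp add: vec_nrm_def)
  note [simp] = X Vd(1) Wd(1) and sq = square_mat_simps[where n = n]
  \<comment> \<open>\<open>V * mat_adjoint W\<close> is the adjoint of a unitary polar factor of
    \<open>X\<close>, so this trace is the sum of the singular values.\<close>
  have "mat_trace (X * (V * mat_adjoint W)) = mat_trace (X * V * mat_adjoint W)" by (simp add: sq)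
  also have "\<dots> = mat_trace (mat_adjoint W * (X * V))"
    by (rule mat_trace_comm[of _ n n]) (simp_all add: sq)
  also have "mat_adjoint W * (X * V) = mat_adjoint W * X * V" by (simp add: sq)
  also have "mat_trace \<dots> = (\<Sum>i<n. f i \<bullet>c col W i)"
    by (simp add: mat_trace_def f_def adjoint_mult_mult_index[of _ n] carrier_matD[OF Wd(1)]
      del: index_mult_mat(1))
  also have "\<dots> = (\<Sum>i<n. complex_of_real (s i))"
  proof (rule sum.cong)
    fix i assume "i \<in> {..<n}"
    then have i: "i < n" by simp
    have "f i \<bullet>c col W i = (complex_of_real (s i) \<cdot>\<^sub>v col W i) \<bullet>c col W i"
      using fW[OF i] nf[OF i] by simp
    then show "f i \<bullet>c col W i = complex_of_real (s i)"
      using unitary_mat_col_nrm(1)[OF W i] unitary_mat_col[OF W i i]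
      by (simp add: cinner_smult_left[of _ n])
  qed simp
  also have "\<dots> = mat_trace (mat_abs X)"
    unfolding PV mat_trace_unitary_conj[OF V mat_diag_dim] mat_trace_mat_diag ..
  finally have "trace_norm X = Re (mat_trace (X * (V * mat_adjoint W)))"
    by (simp add: trace_norm_def)
  also have "\<dots> \<le> cmod (mat_trace (X * (V * mat_adjoint W)))" by (rule complex_Re_le_cmod)
  also have "\<dots> \<le> real n * numerical_radius X"
    using mat_trace_unitary_mult_le[OF X] unitary_mat_mult[OF V unitary_mat_adjoint[OF W]] by blast
  finally show ?thesis .
qed

section \<open>Matricial ranges\<close>

text \<open>Puts a member into the family that \<open>cstar_gen\<close> intersects, which is what
  confines \<open>cstar_gen T\<close> to k by k matrices.\<close>

lemma unital_cstar_subalgebra_full: "unital_cstar_subalgebra k (carrier_mat k k)"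
  by (auto simp: unital_cstar_subalgebra_def)

lemma unital_cstar_subalgebraD:
  assumes "unital_cstar_subalgebra k \<A>"
  shows "\<A> \<subseteq> carrier_mat k k" "1\<^sub>m k \<in> \<A>"
    "\<And>A B. A \<in> \<A> \<Longrightarrow> B \<in> \<A> \<Longrightarrow> A + B \<in> \<A>"
    "\<And>c A. A \<in> \<A> \<Longrightarrow> c \<cdot>\<^sub>m A \<in> \<A>"
    "\<And>A. A \<in> \<A> \<Longrightarrow> mat_adjoint A \<in> \<A>"
  using assms unfolding unital_cstar_subalgebra_def by blast+

lemma self_in_cstar_gen: "T \<in> cstar_gen T"
  by (auto simp: cstar_gen_def)

lemma cstar_gen_closed:
  assumes "T \<in> carrier_mat k k"
  shows "cstar_gen T \<subseteq> carrier_mat k k" "1\<^sub>m k \<in> cstar_gen T"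
    "\<And>A B. A \<in> cstar_gen T \<Longrightarrow> B \<in> cstar_gen T \<Longrightarrow> A + B \<in> cstar_gen T"
    "\<And>c A. A \<in> cstar_gen T \<Longrightarrow> c \<cdot>\<^sub>m A \<in> cstar_gen T"
    "\<And>A. A \<in> cstar_gen T \<Longrightarrow> mat_adjoint A \<in> cstar_gen T"
proof -
  have mem: "A \<in> cstar_gen T \<longleftrightarrow> (\<forall>\<A>. unital_cstar_subalgebra k \<A> \<longrightarrow> T \<in> \<A> \<longrightarrow> A \<in> \<A>)" for A
    using assms by (auto simp: cstar_gen_def)
  show "cstar_gen T \<subseteq> carrier_mat k k"
    using assms unital_cstar_subalgebra_full[of k] mem by blast
  show "1\<^sub>m k \<in> cstar_gen T"
    "\<And>A B. A \<in> cstar_gen T \<Longrightarrow> B \<in> cstar_gen T \<Longrightarrow> A + B \<in> cstar_gen T"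
    "\<And>c A. A \<in> cstar_gen T \<Longrightarrow> c \<cdot>\<^sub>m A \<in> cstar_gen T"
    "\<And>A. A \<in> cstar_gen T \<Longrightarrow> mat_adjoint A \<in> cstar_gen T"
    unfolding mem by (blast intro: unital_cstar_subalgebraD)+
qed

lemma block_mat_single:
  assumes "A \<in> carrier_mat d d"
  shows "block_mat d (Suc 0) (\<lambda>_ _. A) = A"
  using assms by (intro eq_matI) (auto simp: block_mat_def)

text \<open>Complete positivity at block size one.\<close>

lemma CP_positive:
  assumes T: "T \<in> carrier_mat k k" and \<Phi>: "\<Phi> \<in> CP n T"
    and A: "A \<in> cstar_gen T" "positive_mat k A"
  shows "positive_mat n (\<Phi> A)"
proof -
  have "\<Phi> A \<in> carrier_mat n n" using \<Phi> A by (auto simp: CP_def)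
  moreover have "A \<in> carrier_mat k k" using positive_matD(1)[OF A(2)] .
  moreover have "completely_positive k n (cstar_gen T) \<Phi>" using \<Phi> T by (auto simp: CP_def)
  from this[unfolded completely_positive_def, rule_format, of "Suc 0" "\<lambda>_ _. A"]
  have "positive_mat (Suc 0 * k) (block_mat k (Suc 0) (\<lambda>_ _. A)) \<Longrightarrow>
    positive_mat (Suc 0 * n) (block_mat n (Suc 0) (\<lambda>_ _. \<Phi> A))"
    using A(1) by blast
  ultimately show ?thesis using A(2) by (simp add: block_mat_single)
qed

text \<open>Rescaling to unit length. Positivity is tested on all vectors, whereas the numerical
  radius speaks of unit vectors.\<close>

lemma numerical_radius_homogeneous:
  assumes A: "A \<in> carrier_mat n n" and y: "y \<in> carrier_vec n"
  shows "cmod ((A *\<^sub>v y) \<bullet>c y) \<le> numerical_radius A * (vec_nrm y)\<^sup>2"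
proof (cases "y = 0\<^sub>v n")
  case True
  then have "(A *\<^sub>v y) \<bullet>c y = 0" using A by (simp add: cinner_sum[of _ n])
  then show ?thesis using True vec_nrm_eq_0_iff[OF y] by simp
next
  case False
  then have nz: "0 < vec_nrm y"
    using vec_nrm_eq_0_iff[OF y] vec_nrm_nonneg[of y] by (simp add: less_le)
  define c where "c = complex_of_real (1 / vec_nrm y)"
  have "vec_nrm (c \<cdot>\<^sub>v y) = 1" using nz by (simp add: vec_nrm_smult[OF y] c_def norm_divide)
  then have "cmod ((A *\<^sub>v (c \<cdot>\<^sub>v y)) \<bullet>c (c \<cdot>\<^sub>v y)) \<le> numerical_radius A"
    using numerical_radius_ge[OF A, of "c \<cdot>\<^sub>v y"] y by simp
  moreover have "A *\<^sub>v y \<in> carrier_vec n" using A y by auto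
  ultimately have "cmod c * (cmod c * cmod ((A *\<^sub>v y) \<bullet>c y)) \<le> numerical_radius A"
    using y by (simp add: mult_mat_vec[OF A y] cinner_smult_left[of _ n] cinner_smult_right[of _ n] norm_mult)
  then show ?thesis
    using nz by (simp add: c_def norm_divide field_simps power2_eq_square)
qed

lemma matricial_range_carrier:
  assumes "X \<in> matricial_range n T"
  shows "X \<in> carrier_mat n n"
  using assms self_in_cstar_gen by (auto simp: matricial_range_def CP_def)

text \<open>A bound \<open>\<omega>(T) \<le> w\<close> says that \<open>2 w I - c T - (c T)\<^sup>*\<close> is positive for all \<open>|c| = 1\<close>,
  and unital positive maps preserve this.\<close>

lemma numerical_radius_matricial_range_le:
  assumes T: "T \<in> carrier_mat k k" and n: "0 < n" and X: "X \<in> matricial_range n T"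
  shows "numerical_radius X \<le> numerical_radius T"
proof (rule numerical_radius_le[OF matricial_range_carrier[OF X] n])
  fix x assume x: "x \<in> carrier_vec n" "vec_nrm x = 1"
  obtain \<Phi> where \<Phi>: "\<Phi> \<in> CP n T" and X_eq: "X = \<Phi> T" using X by (auto simp: matricial_range_def)
  note closed = cstar_gen_closed[OF T]
  define w where "w = numerical_radius T"
  define a where "a = (\<Phi> T *\<^sub>v x) \<bullet>c x"
  define b where "b = (\<Phi> (mat_adjoint T) *\<^sub>v x) \<bullet>c x"
  have lin: "\<And>A B. A \<in> cstar_gen T \<Longrightarrow> B \<in> cstar_gen T \<Longrightarrow> \<Phi> (A + B) = \<Phi> A + \<Phi> B"
      "\<And>c A. A \<in> cstar_gen T \<Longrightarrow> \<Phi> (c \<cdot>\<^sub>m A) = c \<cdot>\<^sub>m \<Phi> A"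
      "\<Phi> (1\<^sub>m k) = 1\<^sub>m n" and car: "\<And>A. A \<in> cstar_gen T \<Longrightarrow> \<Phi> A \<in> carrier_mat n n"
    using \<Phi> T by (auto simp: CP_def linear_mat_map_def)
  have form: "((s \<cdot>\<^sub>m 1\<^sub>m d + (c \<cdot>\<^sub>m A + c' \<cdot>\<^sub>m B)) *\<^sub>v y) \<bullet>c y =
      s * (y \<bullet>c y) + c * ((A *\<^sub>v y) \<bullet>c y) + c' * ((B *\<^sub>v y) \<bullet>c y)"
    if A: "A \<in> carrier_mat d d" and B: "B \<in> carrier_mat d d" and y: "y \<in> carrier_vec d"
    for s c c' A B d and y :: "complex vec"
  proof -
    have sm: "(r \<cdot>\<^sub>m M) *\<^sub>v y = r \<cdot>\<^sub>v (M *\<^sub>v y)" if "M \<in> carrier_mat d d" for r M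
      using that y by (intro eq_vecI) auto
    have car: "A *\<^sub>v y \<in> carrier_vec d" "B *\<^sub>v y \<in> carrier_vec d" using that by auto
    have "(s \<cdot>\<^sub>m 1\<^sub>m d + (c \<cdot>\<^sub>m A + c' \<cdot>\<^sub>m B)) *\<^sub>v y =
        s \<cdot>\<^sub>v y + (c \<cdot>\<^sub>v (A *\<^sub>v y) + c' \<cdot>\<^sub>v (B *\<^sub>v y))"
      using that by (simp add: add_mult_distrib_mat_vec[of _ d d] sm)
    then show ?thesis using car y
      by (simp add: cinner_add_left[of _ d] cinner_smult_left[of _ d])
  qed
  have key: "0 \<le> complex_of_real (2 * w) - c * a - cnj c * b" if c: "cmod c = 1" for c
  proof -
    define M where "M = complex_of_real (2 * w) \<cdot>\<^sub>m 1\<^sub>m k + ((- c) \<cdot>\<^sub>m T + (- cnj c) \<cdot>\<^sub>m mat_adjoint T)"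
    have M: "M \<in> cstar_gen T"
      unfolding M_def by (intro closed(2-) self_in_cstar_gen)
    have "positive_mat k M"
      unfolding positive_mat_def
    proof (intro conjI ballI)
      show "M \<in> carrier_mat k k" using M closed(1) by blast
      fix y :: "complex vec" assume y: "y \<in> carrier_vec k"
      have Ty: "T *\<^sub>v y \<in> carrier_vec k" "mat_adjoint T *\<^sub>v y \<in> carrier_vec k"
        using mult_mat_vec_carrier[OF T y] mult_mat_vec_carrier[OF mat_adjoint_carrier[OF T] y] .
      define t where "t = (T *\<^sub>v y) \<bullet>c y"
      have "(mat_adjoint T *\<^sub>v y) \<bullet>c y = cnj t"
        using cinner_swap[OF y Ty(2)] cinner_adjoint[OF T y y] by (simp add: t_def)
      then have "(M *\<^sub>v y) \<bullet>c y = complex_of_real (2 * w) * (y \<bullet>c y) - c * t - cnj c * cnj t"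
        unfolding M_def using form[OF T _ y] T by (simp add: t_def)
      also have "\<dots> = complex_of_real (2 * (w * (vec_nrm y)\<^sup>2 - Re (c * t)))"
        by (simp add: cinner_self[OF y] complex_eq_iff)
      finally have eq: "(M *\<^sub>v y) \<bullet>c y = complex_of_real (2 * (w * (vec_nrm y)\<^sup>2 - Re (c * t)))" .
      have "Re (c * t) \<le> cmod (c * t)" by (rule complex_Re_le_cmod)
      also have "\<dots> \<le> w * (vec_nrm y)\<^sup>2"
        using numerical_radius_homogeneous[OF T y] c by (simp add: norm_mult t_def w_def)
      finally show "0 \<le> (M *\<^sub>v y) \<bullet>c y" unfolding eq by (simp add: less_eq_complex_def)
    qed
    then have "0 \<le> (\<Phi> M *\<^sub>v x) \<bullet>c x"
      using positive_matD(2)[OF CP_positive[OF T \<Phi> M]] x by blast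
    moreover have "\<Phi> M = complex_of_real (2 * w) \<cdot>\<^sub>m 1\<^sub>m n
        + ((- c) \<cdot>\<^sub>m \<Phi> T + (- cnj c) \<cdot>\<^sub>m \<Phi> (mat_adjoint T))"
      unfolding M_def by (simp add: lin closed self_in_cstar_gen)
    moreover have "x \<bullet>c x = 1" using x by (simp add: vec_nrm_eq_1_iff[of _ n])
    ultimately show ?thesis
      using form[OF car car x(1), of T "mat_adjoint T"] closed(5) self_in_cstar_gen
      by (simp add: a_def b_def)
  qed
  \<comment> \<open>\<open>CP\<close> does not state that \<Phi> respects adjoints. The left side of
    \<open>key\<close> being real at \<open>c = 1\<close> and at \<open>c = \<i>\<close> yields the
    instance used here.\<close>
  have "b = cnj a"
    using key[of 1] key[of \<i>] by (simp add: less_eq_complex_def complex_eq_iff)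
  then have re: "Re (c * a) \<le> w" if "cmod c = 1" for c
    using key[OF that] by (simp add: less_eq_complex_def algebra_simps)
  show "cmod ((X *\<^sub>v x) \<bullet>c x) \<le> numerical_radius T"
  proof (cases "a = 0")
    case True
    then show ?thesis using re[of 1] by (simp add: a_def X_eq w_def)
  next
    case False
    \<comment> \<open>This choice of \<open>c\<close> rotates \<open>a\<close> onto the positive
      real axis, so the bound on real parts becomes one on the modulus.\<close>
    have "cnj a / cmod a * a = complex_of_real (cmod a)"
      using False complex_norm_square[of a]
      by (simp add: field_simps power2_eq_square del: complex_mult_cnj)
    then have "Re (cnj a / cmod a * a) = cmod a" by simp
    moreover have "cmod (cnj a / cmod a) = 1" using False by (simp add: norm_divide)
    ultimately show ?thesis using re[of "cnj a / cmod a"] by (simp add: a_def X_eq w_def)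
  qed
qed

section \<open>Block matrices and vector states\<close>

lemma sum_lessThan_mult:
  fixes f :: "nat \<Rightarrow> 'a :: comm_monoid_add"
  shows "(\<Sum>p<m * d. f p) = (\<Sum>i<m. \<Sum>a<d. f (i * d + a))"
proof -
  have "(\<Sum>p<m * d. f p) = (\<Sum>i<m. sum f {i * d..<i * d + d})"
    by (rule sum.nat_group[symmetric])
  also have "\<dots> = (\<Sum>i<m. \<Sum>a<d. f (i * d + a))"
  proof (rule sum.cong)
    fix i
    show "sum f {i * d..<i * d + d} = (\<Sum>a<d. f (i * d + a))"
      using sum.shift_bounds_nat_ivl[of f 0 "i * d" d]
      by (simp add: atLeast0LessThan add.commute)
  qed simp
  finally show ?thesis .
qed

text \<open>Expands the forms of both block matrices, over blocks of size \<open>n\<close> and of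
  size \<open>k\<close>, into sums of the same shape that can be compared term by term.\<close>

lemma block_mat_quadratic_form:
  assumes v: "v \<in> carrier_vec (m * d)"
  shows "(block_mat d m F *\<^sub>v v) \<bullet>c v =
    (\<Sum>i<m. \<Sum>j<m. \<Sum>a<d. \<Sum>b<d. F i j $$ (a, b) * v $ (j * d + b) * cnj (v $ (i * d + a)))"
proof -
  have B: "block_mat d m F \<in> carrier_mat (m * d) (m * d)" by (simp add: block_mat_def)
  have lt: "i * d + a < m * d" if "i < m" "a < d" for i a
  proof -
    have "i * d + a < Suc i * d" using that by simp
    also have "\<dots> \<le> m * d" using that by (intro mult_le_mono1) simp
    finally show ?thesis .
  qed
  have "(block_mat d m F *\<^sub>v v) \<bullet>c v =
      (\<Sum>p<m * d. \<Sum>q<m * d. block_mat d m F $$ (p, q) * v $ q * cnj (v $ p))"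
    using B v by (subst cinner_sum[of _ "m * d"])
      (auto simp: scalar_prod_def sum_distrib_right atLeast0LessThan intro!: sum.cong)
  also have "\<dots> = (\<Sum>i<m. \<Sum>a<d. \<Sum>j<m. \<Sum>b<d.
      F i j $$ (a, b) * v $ (j * d + b) * cnj (v $ (i * d + a)))"
    unfolding sum_lessThan_mult
    by (intro sum.cong refl) (simp add: block_mat_def lt)
  also have "\<dots> = (\<Sum>i<m. \<Sum>j<m. \<Sum>a<d. \<Sum>b<d.
      F i j $$ (a, b) * v $ (j * d + b) * cnj (v $ (i * d + a)))"
    by (intro sum.cong[OF refl] sum.swap)
  finally show ?thesis .
qed

text \<open>With \<open>u\<^sub>a\<close> the tensor product of \<open>x\<close> and \<open>(v\<^sub>i\<^sub>a)\<^sub>i\<close>, the quadratic form of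
  \<open>[\<langle>F\<^sub>i\<^sub>j x, x\<rangle> I]\<close> at \<open>v\<close> is the sum over \<open>a\<close> of that of \<open>[F\<^sub>i\<^sub>j]\<close> at \<open>u\<^sub>a\<close>.\<close>

lemma vector_state_completely_positive:
  assumes \<A>: "\<A> \<subseteq> carrier_mat k k" and x: "x \<in> carrier_vec k"
  shows "completely_positive k n \<A> (\<lambda>A. ((A *\<^sub>v x) \<bullet>c x) \<cdot>\<^sub>m 1\<^sub>m n)"
  unfolding completely_positive_def
proof (intro allI impI, elim conjE)
  fix m and F :: "nat \<Rightarrow> nat \<Rightarrow> complex mat"
  assume F: "\<forall>i<m. \<forall>j<m. F i j \<in> \<A>" and pos: "positive_mat (m * k) (block_mat k m F)"
  define G where "G i j = ((F i j *\<^sub>v x) \<bullet>c x) \<cdot>\<^sub>m 1\<^sub>m n" for i j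
  have "0 \<le> (block_mat n m G *\<^sub>v v) \<bullet>c v" if v: "v \<in> carrier_vec (m * n)" for v
  proof -
    define u where "u a = vec (m * k) (\<lambda>p. v $ (p div k * n + a) * x $ (p mod k))" for a
    have u: "u a \<in> carrier_vec (m * k)" for a by (simp add: u_def)
    have ui: "u a $ (i * k + c) = v $ (i * n + a) * x $ c" if "i < m" "c < k" for a i c
    proof -
      have "i * k + c < Suc i * k" using that by simp
      also have "\<dots> \<le> m * k" using that by (intro mult_le_mono1) simp
      finally show ?thesis using that by (simp add: u_def)
    qed
    have Fx: "(F i j *\<^sub>v x) \<bullet>c x = (\<Sum>c<k. \<Sum>d<k. F i j $$ (c, d) * x $ d * cnj (x $ c))"
      if "i < m" "j < m" for i j
    proof -
      have "F i j \<in> carrier_mat k k" using F \<A> that by blast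
      then show ?thesis using x by (subst cinner_sum[of _ k])
        (auto simp: scalar_prod_def sum_distrib_right atLeast0LessThan intro!: sum.cong)
    qed
    have "(block_mat n m G *\<^sub>v v) \<bullet>c v =
        (\<Sum>i<m. \<Sum>j<m. \<Sum>a<n. ((F i j *\<^sub>v x) \<bullet>c x) * v $ (j * n + a) * cnj (v $ (i * n + a)))"
      unfolding block_mat_quadratic_form[OF v]
    proof (intro sum.cong refl)
      fix i j a assume a: "a \<in> {..<n}"
      \<comment> \<open>The blocks of \<open>G\<close> are scalar, so only \<open>b = a\<close>
        survives.\<close>
      have "(\<Sum>b<n. G i j $$ (a, b) * v $ (j * n + b) * cnj (v $ (i * n + a))) =
          (\<Sum>b<n. if b = a then ((F i j *\<^sub>v x) \<bullet>c x) * v $ (j * n + a) * cnj (v $ (i * n + a)) else 0)"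
        using a by (intro sum.cong) (auto simp: G_def)
      then show "(\<Sum>b<n. G i j $$ (a, b) * v $ (j * n + b) * cnj (v $ (i * n + a))) =
          ((F i j *\<^sub>v x) \<bullet>c x) * v $ (j * n + a) * cnj (v $ (i * n + a))"
        using a by simp
    qed
    also have "\<dots> = (\<Sum>i<m. \<Sum>j<m. \<Sum>a<n. \<Sum>c<k. \<Sum>d<k.
        F i j $$ (c, d) * u a $ (j * k + d) * cnj (u a $ (i * k + c)))"
    proof (intro sum.cong refl)
      fix i j a assume ij: "i \<in> {..<m}" "j \<in> {..<m}"
      have "F i j $$ (c, d) * x $ d * cnj (x $ c) * v $ (j * n + a) * cnj (v $ (i * n + a)) =
          F i j $$ (c, d) * u a $ (j * k + d) * cnj (u a $ (i * k + c))"
        if "c < k" "d < k" for c d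
        using ij that by (simp add: ui)
      then show "((F i j *\<^sub>v x) \<bullet>c x) * v $ (j * n + a) * cnj (v $ (i * n + a)) =
          (\<Sum>c<k. \<Sum>d<k. F i j $$ (c, d) * u a $ (j * k + d) * cnj (u a $ (i * k + c)))"
        unfolding Fx[OF lessThan_iff[THEN iffD1, OF ij(1)] lessThan_iff[THEN iffD1, OF ij(2)]] sum_distrib_right
        by (intro sum.cong refl) simp
    qed
    also have "\<dots> = (\<Sum>i<m. \<Sum>a<n. \<Sum>j<m. \<Sum>c<k. \<Sum>d<k.
        F i j $$ (c, d) * u a $ (j * k + d) * cnj (u a $ (i * k + c)))"
      by (intro sum.cong[OF refl] sum.swap)
    also have "\<dots> = (\<Sum>a<n. (block_mat k m F *\<^sub>v u a) \<bullet>c u a)"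
      unfolding block_mat_quadratic_form[OF u] by (rule sum.swap)
    also have "0 \<le> \<dots>"
      using positive_matD(2)[OF pos u] by (intro sum_nonneg)
    finally show ?thesis .
  qed
  then show "positive_mat (m * n) (block_mat n m (\<lambda>i j. ((F i j *\<^sub>v x) \<bullet>c x) \<cdot>\<^sub>m 1\<^sub>m n))"
    by (simp add: positive_mat_def block_mat_def G_def[abs_def])
qed

lemma scalar_in_matricial_range:
  assumes T: "T \<in> carrier_mat k k" and x: "x \<in> carrier_vec k" "vec_nrm x = 1"
  shows "((T *\<^sub>v x) \<bullet>c x) \<cdot>\<^sub>m 1\<^sub>m n \<in> matricial_range n T"
proof -
  define \<Phi> where "\<Phi> A = ((A *\<^sub>v x) \<bullet>c x) \<cdot>\<^sub>m (1\<^sub>m n :: complex mat)" for A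
  note sub = cstar_gen_closed(1)[OF T]
  have sm: "(r \<cdot>\<^sub>m M) *\<^sub>v x = r \<cdot>\<^sub>v (M *\<^sub>v x)" if "M \<in> carrier_mat k k" for r M
    using that x by (intro eq_vecI) auto
  have "linear_mat_map (cstar_gen T) \<Phi>"
    unfolding linear_mat_map_def
  proof (intro conjI ballI allI)
    fix A B assume "A \<in> cstar_gen T" "B \<in> cstar_gen T"
    then have AB: "A \<in> carrier_mat k k" "B \<in> carrier_mat k k" using sub by auto
    then have "A *\<^sub>v x \<in> carrier_vec k" "B *\<^sub>v x \<in> carrier_vec k" using x by auto
    then show "\<Phi> (A + B) = \<Phi> A + \<Phi> B"
      using AB x by (intro eq_matI)
        (auto simp: \<Phi>_def add_mult_distrib_mat_vec[of _ k k] cinner_add_left[of _ k])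
  next
    fix c A assume "A \<in> cstar_gen T"
    then have A: "A \<in> carrier_mat k k" using sub by auto
    then have "A *\<^sub>v x \<in> carrier_vec k" using x by auto
    then show "\<Phi> (c \<cdot>\<^sub>m A) = c \<cdot>\<^sub>m \<Phi> A"
      using A x by (intro eq_matI) (auto simp: \<Phi>_def sm cinner_smult_left[of _ k])
  qed
  moreover have "\<Phi> (1\<^sub>m k) = 1\<^sub>m n"
    using x by (intro eq_matI) (auto simp: \<Phi>_def vec_nrm_eq_1_iff[of _ k])
  moreover have "completely_positive k n (cstar_gen T) \<Phi>"
    unfolding \<Phi>_def[abs_def] by (rule vector_state_completely_positive[OF sub x(1)])
  ultimately have "\<Phi> \<in> CP n T" using T by (auto simp: CP_def \<Phi>_def)
  then show ?thesis unfolding matricial_range_def by (rule rev_image_eqI) (simp add: \<Phi>_def)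
qed

section \<open>Scalar matrices and the three suprema\<close>

lemma mat_trace_scalar: "mat_trace (c \<cdot>\<^sub>m 1\<^sub>m n) = of_nat n * c"
  by (simp add: mat_trace_def)

lemma trace_norm_scalar: "trace_norm (c \<cdot>\<^sub>m 1\<^sub>m n) = real n * cmod c"
proof -
  define B where "B = complex_of_real (cmod c) \<cdot>\<^sub>m 1\<^sub>m n"
  have "positive_mat n B"
    unfolding positive_mat_def
  proof (intro conjI ballI)
    fix v :: "complex vec" assume v: "v \<in> carrier_vec n"
    have "B *\<^sub>v v = complex_of_real (cmod c) \<cdot>\<^sub>v v"
      using v unfolding B_def by (intro eq_vecI) auto
    then have "(B *\<^sub>v v) \<bullet>c v = complex_of_real (cmod c * (vec_nrm v)\<^sup>2)"
      using v by (simp add: cinner_smult_left[of _ n] cinner_self[of _ n])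
    then show "0 \<le> (B *\<^sub>v v) \<bullet>c v" by (simp add: less_eq_complex_def)
  qed (simp add: B_def)
  moreover have "B * B = mat_adjoint (c \<cdot>\<^sub>m 1\<^sub>m n) * (c \<cdot>\<^sub>m 1\<^sub>m n)"
  proof -
    have "B * B = complex_of_real ((cmod c)\<^sup>2) \<cdot>\<^sub>m 1\<^sub>m n"
      unfolding B_def by (intro eq_matI) (auto simp: power2_eq_square)
    moreover have "mat_adjoint (c \<cdot>\<^sub>m 1\<^sub>m n) = cnj c \<cdot>\<^sub>m 1\<^sub>m n"
      by (intro eq_matI) auto
    moreover have "(cnj c \<cdot>\<^sub>m 1\<^sub>m n) * (c \<cdot>\<^sub>m 1\<^sub>m n) = (c * cnj c) \<cdot>\<^sub>m 1\<^sub>m n"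
      by (intro eq_matI) (auto simp: mult.commute)
    ultimately show ?thesis by (simp only: complex_norm_square)
  qed
  ultimately have "mat_abs (c \<cdot>\<^sub>m 1\<^sub>m n) = B"
    unfolding mat_abs_def by (rule mat_sqrt_eqI)
  then show ?thesis by (simp add: trace_norm_def B_def mat_trace_scalar)
qed

text \<open>The common pattern of the three equalities, with \<open>r = n\<close> for trace and
  trace norm and \<open>r = 1\<close> for the numerical radius. In the extended reals no boundedness
  has to be shown before the supremum is formed.\<close>

lemma SUP_eq_mult_numerical_radius:
  assumes T: "T \<in> carrier_mat k k" "0 < k" and r: "0 < r"
    and ub: "\<And>X. X \<in> S \<Longrightarrow> g X \<le> r * numerical_radius T"
    and lb: "\<And>x. x \<in> carrier_vec k \<Longrightarrow> vec_nrm x = 1 \<Longrightarrow>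
      \<exists>X \<in> S. r * cmod ((T *\<^sub>v x) \<bullet>c x) \<le> g X"
  shows "(SUP X \<in> S. ereal (g X)) = ereal (r * numerical_radius T)"
proof (rule SUP_eqI)
  show "ereal (g X) \<le> ereal (r * numerical_radius T)" if "X \<in> S" for X
    using ub[OF that] by simp
  fix y assume y: "\<And>X. X \<in> S \<Longrightarrow> ereal (g X) \<le> y"
  have bound: "ereal (r * cmod ((T *\<^sub>v x) \<bullet>c x)) \<le> y"
    if "x \<in> carrier_vec k" "vec_nrm x = 1" for x
    using lb[OF that] y by (meson ereal_less_eq(3) order_trans)
  show "ereal (r * numerical_radius T) \<le> y"
  proof (cases y)
    case (real z)
    have "numerical_radius T \<le> z / r"
      using bound r by (intro numerical_radius_le[OF T]) (auto simp: real field_simps)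
    then show ?thesis using r by (simp add: real field_simps)
  next
    \<comment> \<open>Excluded by the real lower bound coming from a unit vector, which exists
      because \<open>0 < k\<close>.\<close>
    case MInf
    then show ?thesis using bound[OF unit_vec_carrier unit_vec_nrm[OF T(2)]] by simp
  qed simp
qed

theorem mainTheorem3:
  fixes k n :: nat and T :: "complex mat"
  assumes "0 < k" and "T \<in> carrier_mat k k" and "0 < n"
  shows "ereal (numerical_radius T) =
           ereal (1 / real n) * (SUP X \<in> matricial_range n T. ereal (cmod (mat_trace X)))
       \<and> ereal (numerical_radius T) =
           ereal (1 / real n) * (SUP X \<in> matricial_range n T. ereal (trace_norm X))
       \<and> ereal (numerical_radius T) =
           (SUP X \<in> matricial_range n T. ereal (numerical_radius X))"
proof -
  note sup_eq = SUP_eq_mult_numerical_radius[OF assms(2,1)]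
  have n: "0 < real n" using assms(3) by simp
  have le: "real n * numerical_radius X \<le> real n * numerical_radius T"
    if "X \<in> matricial_range n T" for X
    using numerical_radius_matricial_range_le[OF assms(2,3) that] n by simp
  have in_range: "((T *\<^sub>v x) \<bullet>c x) \<cdot>\<^sub>m 1\<^sub>m n \<in> matricial_range n T"
    if "x \<in> carrier_vec k" "vec_nrm x = 1" for x
    using scalar_in_matricial_range[OF assms(2) that] .
  \<comment> \<open>The upper bound chains |Tr X| \<le> n \<omega>(X) \<le> n \<omega>(T); the
    scalar matrix of each unit vector supplies the lower bound.\<close>
  have "(SUP X \<in> matricial_range n T. ereal (cmod (mat_trace X))) = ereal (real n * numerical_radius T)"
    using mat_trace_le_numerical_radius[OF matricial_range_carrier] le
    by (intro sup_eq[OF n] order_trans[OF _ le] bexI[OF _ in_range])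
      (auto simp: mat_trace_scalar norm_mult)
  moreover have "(SUP X \<in> matricial_range n T. ereal (trace_norm X)) = ereal (real n * numerical_radius T)"
    using trace_norm_le_numerical_radius[OF matricial_range_carrier] le
    by (intro sup_eq[OF n] order_trans[OF _ le] bexI[OF _ in_range])
      (auto simp: trace_norm_scalar)
  moreover have "(SUP X \<in> matricial_range n T. ereal (numerical_radius X)) = ereal (1 * numerical_radius T)"
  proof (rule sup_eq)
    fix x assume x: "x \<in> carrier_vec k" "vec_nrm x = 1"
    define c where "c = (T *\<^sub>v x) \<bullet>c x"
    \<comment> \<open>The trace bound, read backwards on a scalar matrix, shows that its numerical
      radius is at least |c|.\<close>
    have "real n * cmod c \<le> real n * numerical_radius (c \<cdot>\<^sub>m 1\<^sub>m n)"
      using mat_trace_le_numerical_radius[of "c \<cdot>\<^sub>m 1\<^sub>m n" n] by (simp add: mat_trace_scalar norm_mult)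
    then show "\<exists>X \<in> matricial_range n T. 1 * cmod ((T *\<^sub>v x) \<bullet>c x) \<le> numerical_radius X"
      using in_range[OF x] n unfolding c_def by (intro bexI[of _ "((T *\<^sub>v x) \<bullet>c x) \<cdot>\<^sub>m 1\<^sub>m n"]) simp_all
  qed (use numerical_radius_matricial_range_le[OF assms(2,3)] in auto)
  ultimately show ?thesis using n by simp
qed

end
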